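(* Let $f_1,\dots,f_m:\mathbb{R}^d\to\mathbb{R}$ each be convex and $L$-smooth, let $G:\mathbb{R}^d\to\mathbb{R}\cup\{\pm\infty\}$ be proper, closed and convex, and let $x^\star$ be an optimal solution of $\min_{x\in\mathbb{R}^d}F(x)+G(x)$ with $F=\frac1m\sum_{i=1}^mf_i$; put $X^\star=1(x^\star)^\top$. Let $C,D\in\mathbb{S}^m$ satisfy: $1^\top D1=m$; $C\succeq0$ and $\mathrm{Null}(C)=\mathrm{span}(1)$; $0\prec D\preceq I-\frac C2$. Let $X^0\in\mathbb{R}^{m\times d}$ with $X^0\neq X^\star$, $\underline Y^0=0$, and for $k\ge0$ $$\underline X^{k+1}=DX^k-\gamma\big(\nabla f(X^k)+\underline Y^k\big),\qquad X^{k+1}=\mathrm{prox}_{\gamma g}(\underline X^{k+1}),\qquad \underline Y^{k+1}=\underline Y^k+\frac1\gamma CX^{k+1}.$$ Then the stepsize $\gamma\in(0,\lambda_{\min}(D)/L]$ that minimizes $$\frac1k\left(\frac1{2\gamma}\|X^0-X^\star\|_D^2+2\gamma\,\frac1{\lambda_2(C)}\|\nabla f(X^\star)\|^2\right)$$ is $$\gamma=\min\left(\frac{\lambda_{\min}(D)}{L},\;\frac12\sqrt{\lambda_2(C)}\,\frac{\|X^0-X^\star\|_D}{\|\nabla f(X^\star)\|}\right),$$ and with this stepsize, for every $k\ge1$ and $\widehat X^k=\frac1k\sum_{t=1}^kX^t$, $$M(\widehat X^k)\le\frac1k\max\left\{\frac{L\|X^0-X^\star\|_D^2}{\lambda_{\min}(D)},\;2\sqrt{\frac{1}{\lambda_2(C)}}\,\|X^0-X^\star\|_D\,\|\nabla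 f(X^\star)\|\right\},$$ where $$M(X)=\max\big\{\|(I-J)X\|\,\|Y^\star\|,\;|(f+g)(X)-(f+g)(X^\star)|\big\},\qquad Y^\star=-\big(\nabla f(X^\star)+1(\xi^\star)^\top\big),$$ and $\xi^\star\in\partial G(x^\star)$ is such that $\xi^\star+\nabla F(x^\star)=0$. (The second argument of the minimum is read as $+\infty$ when $\nabla f(X^\star)=0$.)
   Context: $\mathbb{S}^m$ is the set of real symmetric $m\times m$ matrices; $\preceq,\prec$ denote the Loewner order. $1\in\mathbb{R}^m$ is the all-ones vector and $J=\frac1m11^\top$. For $X=[x_1,\dots,x_m]^\top\in\mathbb{R}^{m\times d}$ (row $i$ is $x_i^\top$), $f(X)=\sum_{i=1}^m f_i(x_i)$, $g(X)=\sum_{i=1}^mG(x_i)$, $\nabla f(X)=[\nabla f_1(x_1),\dots,\nabla f_m(x_m)]^\top$, and $\mathrm{prox}_{\gamma g}(X)=\arg\min_{Y\in\mathbb{R}^{m\times d}} g(Y)+\frac1{2\gamma}\|X-Y\|^2$. "$L$-smooth" means differentiable with $L$-Lipschitz gradient; $\partial G$ is the convex subdifferential. $\|\cdot\|$ is the Frobenius norm and $\|X\|_D^2=\mathrm{tr}(X^\top DX)$. $\lambda_{\min}$ is the smallest eigenvalue and $\lambda_2(C)$ the second smallest eigenvalue of $C$. *)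

theory Defs
  imports "HOL-Analysis.Analysis"
begin

definition grad :: "('a::real_inner \<Rightarrow> real) \<Rightarrow> 'a \<Rightarrow> 'a" where
  "grad f x = (THE D. GDERIV f x :> D)"

definition L_smooth :: "real \<Rightarrow> ('a::euclidean_space \<Rightarrow> real) \<Rightarrow> bool" where
  "L_smooth L f \<longleftrightarrow> (\<forall>x. f differentiable (at x)) \<and> L-lipschitz_on UNIV (grad f)"

text \<open>The library's \<^const>\<open>epigraph\<close> and \<^const>\<open>convex_on\<close> are for real-valued functions only.
  The epigraph below still consists of pairs with a \<^emph>\<open>real\<close> second component.\<close>

definition ereal_epigraph :: "('a \<Rightarrow> ereal) \<Rightarrow> ('a \<times> real) set" where
  "ereal_epigraph G = {(x, r). G x \<le> ereal r}"

definition proper_fun :: "('a \<Rightarrow> ereal) \<Rightarrow> bool" where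
  "proper_fun G \<longleftrightarrow> (\<forall>x. G x \<noteq> -\<infinity>) \<and> (\<exists>x. G x \<noteq> \<infinity>)"

definition closed_fun :: "('a::topological_space \<Rightarrow> ereal) \<Rightarrow> bool" where
  "closed_fun G \<longleftrightarrow> closed (ereal_epigraph G)"

definition convex_fun :: "('a::real_vector \<Rightarrow> ereal) \<Rightarrow> bool" where
  "convex_fun G \<longleftrightarrow> convex (ereal_epigraph G)"

definition subdifferential :: "('a::real_inner \<Rightarrow> ereal) \<Rightarrow> 'a \<Rightarrow> 'a set" where
  "subdifferential G x = {\<xi>. \<forall>y. G x + ereal (\<xi> \<bullet> (y - x)) \<le> G y}"

definition prox :: "real \<Rightarrow> ('a::real_normed_vector \<Rightarrow> ereal) \<Rightarrow> 'a \<Rightarrow> 'a" where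
  "prox \<gamma> g X = (ARG_MIN (\<lambda>Y. g Y + ereal (1 / (2 * \<gamma>) * (norm (X - Y))\<^sup>2)) Y. True)"

definition symmetric_matrix :: "real^'n^'n \<Rightarrow> bool" where
  "symmetric_matrix A \<longleftrightarrow> transpose A = A"

text \<open>The two Loewner orders are meant for symmetric matrices.\<close>

definition loewner_le :: "real^'n^'n \<Rightarrow> real^'n^'n \<Rightarrow> bool" where
  "loewner_le A B \<longleftrightarrow> (\<forall>x. 0 \<le> x \<bullet> ((B - A) *v x))"

definition loewner_less :: "real^'n^'n \<Rightarrow> real^'n^'n \<Rightarrow> bool" where
  "loewner_less A B \<longleftrightarrow> (\<forall>x. x \<noteq> 0 \<longrightarrow> 0 < x \<bullet> ((B - A) *v x))"

definition null_space :: "real^'n^'m \<Rightarrow> (real^'n) set" where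
  "null_space A = {x. A *v x = 0}"

definition eigenvalues :: "real^'n^'n \<Rightarrow> real set" where
  "eigenvalues A = {l. \<exists>v. v \<noteq> 0 \<and> A *v v = l *\<^sub>R v}"

definition lambda_min :: "real^'n^'n \<Rightarrow> real" where
  "lambda_min A = Min (eigenvalues A)"

text \<open>Eigenvalues are counted with the dimension of their eigenspace, which for a symmetric
  matrix is also their multiplicity as a root of the characteristic polynomial.\<close>

definition eigenvalue_mset :: "real^'n^'n \<Rightarrow> real multiset" where
  "eigenvalue_mset A = (\<Sum>l\<in>eigenvalues A. replicate_mset (dim {v. A *v v = l *\<^sub>R v}) l)"

text \<open>The second smallest eigenvalue with multiplicity (list positions start at 0);
  meaningful for symmetric matrices of size at least 2.\<close>

definition lambda2 :: "real^'n^'n \<Rightarrow> real" where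
  "lambda2 A = sorted_list_of_multiset (eigenvalue_mset A) ! 1"

text \<open>On \<^typ>\<open>real^'d^'m\<close> the function \<^const>\<open>norm\<close> is the Frobenius norm.\<close>

definition wnorm :: "real^'m^'m \<Rightarrow> real^'d^'m \<Rightarrow> real" where
  "wnorm D X = sqrt (trace (transpose X ** D ** X))"

definition J_mat :: "real^'m^'m" where
  "J_mat = (\<chi> i j. 1 / real CARD('m))"

text \<open>The matrix \<open>1 x\<^sup>T\<close>, all of whose rows are \<open>x\<close>.\<close>

definition ones_outer :: "real^'d \<Rightarrow> real^'d^'m" where
  "ones_outer x = (\<chi> i. x)"

text \<open>A matrix \<open>X\<close> in \<^typ>\<open>real^'d^'m\<close> has the rows \<open>X $ i\<close>, one for each \<open>i\<close>.\<close>

definition f_sum :: "('m::finite \<Rightarrow> real^'d \<Rightarrow> real) \<Rightarrow> real^'d^'m \<Rightarrow> real" where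
  "f_sum f X = (\<Sum>i\<in>UNIV. f i (X $ i))"

definition f_avg :: "('m::finite \<Rightarrow> real^'d \<Rightarrow> real) \<Rightarrow> real^'d \<Rightarrow> real" where
  "f_avg f x = 1 / real CARD('m) * (\<Sum>i\<in>UNIV. f i x)"

definition g_sum :: "(real^'d \<Rightarrow> ereal) \<Rightarrow> real^'d^'m \<Rightarrow> ereal" where
  "g_sum G X = (\<Sum>i\<in>UNIV. G (X $ i))"

definition grad_rows :: "('m::finite \<Rightarrow> real^'d \<Rightarrow> real) \<Rightarrow> real^'d^'m \<Rightarrow> real^'d^'m" where
  "grad_rows f X = (\<chi> i. grad (f i) (X $ i))"

definition fg_obj :: "('m::finite \<Rightarrow> real^'d \<Rightarrow> real) \<Rightarrow> (real^'d \<Rightarrow> ereal) \<Rightarrow> real^'d^'m \<Rightarrow> ereal" where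
  "fg_obj f G X = ereal (f_sum f X) + g_sum G X"

text \<open>The merit function is \<open>\<infinity>\<close> where the objective is, provided it is finite at \<open>Xs\<close>.\<close>

definition merit ::
  "('m::finite \<Rightarrow> real^'d \<Rightarrow> real) \<Rightarrow> (real^'d \<Rightarrow> ereal) \<Rightarrow> real^'d^'m \<Rightarrow> real^'d^'m \<Rightarrow> real^'d^'m \<Rightarrow> ereal"
  where
  "merit f G Xs Ys X =
     max (ereal (norm ((mat 1 - J_mat) ** X) * norm Ys)) \<bar>fg_obj f G X - fg_obj f G Xs\<bar>"

end

theory Submission
  imports Defs
begin

text \<open>The smoothness of the \<open>f\<^sub>i\<close> and the optimality condition of the proximal step bound the
  Lagrangian gap \<open>(f + g)(X\<^sup>k) - (f + g)(X\<^sup>\<star>) + \<langle>V, X\<^sup>k\<rangle>\<close> for every \<open>V\<close> with zero column sums. Write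
  \<open>Y\<^sup>k = C Z\<^sup>k / \<gamma>\<close> with \<open>Z\<^sup>k = \<Sum>\<^bsub>t \<le> k\<^esub> X\<^sup>t\<close> and \<open>V = C W / \<gamma>\<close>. Since \<open>D \<preceq> I - C / 2\<close>,
  the bound is a difference of consecutive values of
  \<open>(\<parallel>X\<^sup>k - X\<^sup>\<star>\<parallel>\<^sub>D\<^sup>2 + \<parallel>Z\<^sup>k - W\<parallel>\<^sub>C\<^sup>2) / (2 \<gamma>)\<close>, so averaging gives an \<open>O(1/k)\<close> bound.
  The multiplier \<open>V\<close> that points along \<open>I - J\<close> applied to the averaged iterate and has norm
  \<open>2 \<parallel>Y\<^sup>\<star>\<parallel>\<close>, together with the saddle point inequality at \<open>Y\<^sup>\<star>\<close>, controls both terms of the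
  merit function.\<close>

section \<open>Symmetric matrices and their eigenvalues\<close>

lemma column_matrix_mult: "column c (A ** X) = A *v column c (X :: real^'d^'m)"
  by (simp add: column_def matrix_matrix_mult_def matrix_vector_mult_def vec_eq_iff)

lemma inner_columns: "X \<bullet> Y = (\<Sum>c\<in>UNIV. column c X \<bullet> column c (Y :: real^'d^'m))"
  unfolding inner_vec_def column_def by (simp add: sum.swap[where A = "UNIV :: 'm set"])

lemma symmetric_inner_vec:
  "symmetric_matrix A \<Longrightarrow> (A *v x) \<bullet> y = x \<bullet> (A *v y)"
  by (metis symmetric_matrix_def dot_lmul_matrix vector_transpose_matrix)

lemma symmetric_inner_matrix:
  "symmetric_matrix A \<Longrightarrow> (A ** X) \<bullet> Y = X \<bullet> (A ** (Y :: real^'d^'m))"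
  by (simp add: inner_columns column_matrix_mult symmetric_inner_vec)

text \<open>The inner product is a sum over columns and \<open>B\<close> acts on each column
  separately, so a bound on vectors can be summed. This carries Loewner and eigenvalue bounds over
  to the iterates.\<close>

lemma quadratic_form_lower_bound_columns:
  fixes X :: "real^'d^'m"
  assumes "\<And>x. c * (x \<bullet> x) \<le> x \<bullet> (B *v x)"
  shows "c * (X \<bullet> X) \<le> X \<bullet> (B ** X)"
  unfolding inner_columns column_matrix_mult sum_distrib_left by (intro sum_mono assms)

lemma wnorm_inner: "wnorm D X = sqrt (X \<bullet> (D ** (X :: real^'d^'m)))"
proof -
  have "trace (transpose X ** D ** X) = X \<bullet> (D ** X)"
    unfolding matrix_mul_assoc[symmetric] inner_columns column_matrix_mult
    by (simp add: trace_def matrix_matrix_mult_def[of "transpose X"] inner_vec_def transpose_def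
        column_def matrix_matrix_mult_def matrix_vector_mult_def)
  then show ?thesis by (simp add: wnorm_def)
qed

text \<open>Perturbing \<open>v\<close> in the direction \<open>A v\<close> would make the form negative unless \<open>A v = 0\<close>.\<close>

lemma psd_form_zero_imp_null:
  fixes A :: "real^'n^'n"
  assumes sym: "symmetric_matrix A" and S: "subspace S" and inv: "\<And>x. x \<in> S \<Longrightarrow> A *v x \<in> S"
    and psd: "\<And>x. x \<in> S \<Longrightarrow> 0 \<le> x \<bullet> (A *v x)" and v: "v \<in> S" "v \<bullet> (A *v v) = 0"
  shows "A *v v = 0"
proof (rule ccontr)
  assume "A *v v \<noteq> 0"
  define r b where "r = A *v v" and "b = r \<bullet> (A *v r)"
  have a: "r \<bullet> r > 0" using \<open>A *v v \<noteq> 0\<close> by (simp add: r_def)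
  have rS: "r \<in> S" unfolding r_def using v(1) by (rule inv)
  have b: "b \<ge> 0" unfolding b_def using rS by (rule psd)
  \<comment> \<open>For small negative \<open>t\<close> the linear term dominates; this choice works
    for every \<open>b \<ge> 0\<close>, and \<open>+ 1\<close> keeps the denominator positive when
    \<open>b = 0\<close>.\<close>
  define t where "t = - (r \<bullet> r) / (b + 1)"
  have "v + t *\<^sub>R r \<in> S" using v rS S by (auto intro: subspace_add subspace_mul)
  then have "0 \<le> (v + t *\<^sub>R r) \<bullet> (A *v (v + t *\<^sub>R r))" by (rule psd)
  also have "\<dots> = 2 * t * (r \<bullet> r) + t\<^sup>2 * b"
    using symmetric_inner_vec[OF sym, of v r] v(2) unfolding r_def[symmetric]
    by (simp add: matrix_vector_right_distrib matrix_vector_mult_scaleR inner_add_left inner_add_right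
        inner_commute power2_eq_square algebra_simps b_def r_def[symmetric])
  also have "\<dots> = - ((r \<bullet> r)\<^sup>2 * (b + 2)) / (b + 1)\<^sup>2"
    using b by (simp add: t_def field_simps power2_eq_square add_nonneg_eq_0_iff)
  also have "\<dots> < 0" using a b by (intro divide_neg_pos) (auto simp: zero_less_power2)
  finally show False by simp
qed

text \<open>Compactness of the unit sphere in \<open>S\<close> yields a minimizer \<open>v\<close>
  of the form, and scaling extends the bound to all of \<open>S\<close>. Then
  \<open>A - \<mu> I\<close> is nonnegative on the invariant subspace \<open>S\<close> and its form
  vanishes at \<open>v\<close>, which puts \<open>v\<close> into its kernel.\<close>

lemma rayleigh_minimizer:
  fixes A :: "real^'n^'n"
  assumes sym: "symmetric_matrix A" and S: "subspace S" and inv: "\<And>x. x \<in> S \<Longrightarrow> A *v x \<in> S"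
    and w: "w \<in> S" "w \<noteq> 0"
  obtains v \<mu> where "v \<in> S" "v \<noteq> 0" "A *v v = \<mu> *\<^sub>R v"
    and "\<And>x. x \<in> S \<Longrightarrow> \<mu> * (x \<bullet> x) \<le> x \<bullet> (A *v x)"
proof -
  let ?q = "\<lambda>x. x \<bullet> (A *v x)"
  have "compact (sphere 0 1 \<inter> S)"
    by (intro compact_Int_closed compact_sphere closed_subspace S)
  moreover have "(1 / norm w) *\<^sub>R w \<in> sphere 0 1 \<inter> S"
    using w S by (auto intro: subspace_mul)
  moreover have "continuous_on (sphere 0 1 \<inter> S) ?q"
    by (intro continuous_intros linear_continuous_on matrix_vector_mul_bounded_linear)
  ultimately obtain v where v: "v \<in> sphere 0 1 \<inter> S" and vmin: "\<And>x. x \<in> sphere 0 1 \<inter> S \<Longrightarrow> ?q v \<le> ?q x"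
    using continuous_attains_inf[of "sphere 0 1 \<inter> S" ?q] by blast
  have vS: "v \<in> S" and nv: "norm v = 1" "v \<bullet> v = 1" using v by (auto simp: dot_square_norm)
  define \<mu> where "\<mu> = ?q v"
  have q: "\<mu> * (x \<bullet> x) \<le> ?q x" if "x \<in> S" for x
  proof (cases "x = 0")
    case False
    have "(1 / norm x) *\<^sub>R x \<in> sphere 0 1 \<inter> S"
      using that False S by (auto intro: subspace_mul)
    then have "\<mu> \<le> (1 / norm x) * ((1 / norm x) * ?q x)"
      using vmin[of "(1 / norm x) *\<^sub>R x"] unfolding \<mu>_def by (simp add: matrix_vector_mult_scaleR)
    then show ?thesis using False by (simp add: field_simps dot_square_norm power2_eq_square)
  qed simp
  define B where "B = A - \<mu> *\<^sub>R mat 1"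
  have B: "B *v x = A *v x - \<mu> *\<^sub>R x" for x
    by (simp add: B_def matrix_vector_mult_diff_rdistrib scaleR_matrix_vector_assoc[symmetric])
  have "B *v v = 0"
  proof (rule psd_form_zero_imp_null[OF _ S])
    show "symmetric_matrix B"
      using sym by (simp add: symmetric_matrix_def B_def transpose_def vec_eq_iff mat_def)
    show "B *v x \<in> S" if "x \<in> S" for x
      unfolding B using that S inv by (auto intro: subspace_diff subspace_mul)
    show "0 \<le> x \<bullet> (B *v x)" if "x \<in> S" for x
      using q[OF that] by (simp add: B inner_diff_right)
    show "v \<in> S" by (rule vS)
    show "v \<bullet> (B *v v) = 0" by (simp add: B inner_diff_right nv \<mu>_def)
  qed
  then have "A *v v = \<mu> *\<^sub>R v" by (simp add: B)
  moreover have "v \<noteq> 0" using nv by auto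
  ultimately show thesis using that vS q by blast
qed

section \<open>Smallest and second smallest eigenvalues\<close>

lemma symmetric_eigenvectors_orthogonal:
  assumes "symmetric_matrix A" "A *v v = a *\<^sub>R v" "A *v w = b *\<^sub>R w" "a \<noteq> b"
  shows "v \<bullet> w = 0"
  using symmetric_inner_vec[OF assms(1), of v w] assms(2-4) by simp

text \<open>One eigenvector per eigenvalue gives an orthogonal family without 0, hence an
  independent and finite one. \<open>Min\<close> and the sum over \<open>eigenvalues A\<close>
  depend on this.\<close>

lemma finite_eigenvalues:
  assumes sym: "symmetric_matrix (A :: real^'n^'n)"
  shows "finite (eigenvalues A)"
proof -
  have "\<forall>l\<in>eigenvalues A. \<exists>v. v \<noteq> 0 \<and> A *v v = l *\<^sub>R v" by (simp add: eigenvalues_def)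
  from bchoice[OF this]
  obtain ev where ev: "\<And>l. l \<in> eigenvalues A \<Longrightarrow> ev l \<noteq> 0 \<and> A *v ev l = l *\<^sub>R ev l"
    by blast
  have inj: "inj_on ev (eigenvalues A)"
    using ev by (intro inj_onI) (metis scaleR_cancel_right)
  have "pairwise orthogonal (ev ` eigenvalues A)"
    using ev by (auto simp: pairwise_def orthogonal_def intro!: symmetric_eigenvectors_orthogonal[OF sym])
  moreover have "0 \<notin> ev ` eigenvalues A" using ev by force
  ultimately have "finite (ev ` eigenvalues A)"
    by (intro finiteI_independent pairwise_orthogonal_independent)
  then show ?thesis using inj by (rule finite_imageD)
qed

lemma lambda_min_symmetric:
  fixes A :: "real^'n^'n"
  assumes sym: "symmetric_matrix A"
  shows "lambda_min A \<in> eigenvalues A" and "lambda_min A * (x \<bullet> x) \<le> x \<bullet> (A *v x)"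
proof -
  have "(1 :: real^'n) \<noteq> 0" by (simp add: vec_eq_iff)
  then obtain v \<mu> where v: "v \<noteq> 0" "A *v v = \<mu> *\<^sub>R v"
    and q: "\<And>x. \<mu> * (x \<bullet> x) \<le> x \<bullet> (A *v x)"
    using rayleigh_minimizer[OF sym subspace_UNIV, of 1] by auto
  have \<mu>: "\<mu> \<in> eigenvalues A" using v by (auto simp: eigenvalues_def)
  have min: "\<mu> \<le> l" if l: "l \<in> eigenvalues A" for l
  proof -
    obtain w where "w \<noteq> 0" "A *v w = l *\<^sub>R w" using l by (auto simp: eigenvalues_def)
    then show ?thesis using q[of w] by simp
  qed
  have "lambda_min A = \<mu>"
    unfolding lambda_min_def using finite_eigenvalues[OF sym] \<mu> min by (intro Min_eqI) auto
  then show "lambda_min A \<in> eigenvalues A" "lambda_min A * (x \<bullet> x) \<le> x \<bullet> (A *v x)"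
    using \<mu> q by auto
qed

lemma lambda_min_pos:
  fixes A :: "real^'n^'n"
  assumes "symmetric_matrix A" "loewner_less 0 A"
  shows "0 < lambda_min A"
proof -
  obtain v where "v \<noteq> 0" "A *v v = lambda_min A *\<^sub>R v"
    using lambda_min_symmetric(1)[OF assms(1)] by (auto simp: eigenvalues_def)
  moreover have "0 < v \<bullet> (A *v v)"
    using assms(2) \<open>v \<noteq> 0\<close> unfolding loewner_less_def diff_zero by blast
  ultimately show ?thesis using zero_less_mult_pos2[of "lambda_min A" "v \<bullet> v"] by simp
qed

text \<open>The kernel is a line, so 0 is a simple eigenvalue, and all other eigenvectors are
  orthogonal to 1. Hence the second entry of the sorted spectrum is the Rayleigh minimum on the
  complement of 1, where \<open>C\<close> has no kernel.\<close>

lemma lambda2_null_span_one: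
  fixes C :: "real^'m^'m"
  assumes m2: "CARD('m) \<ge> 2" and sym: "symmetric_matrix C" and psd: "loewner_le 0 C"
    and null: "null_space C = span {1}"
  shows "0 < lambda2 C" and "x \<bullet> 1 = 0 \<Longrightarrow> lambda2 C * (x \<bullet> x) \<le> x \<bullet> (C *v x)"
proof -
  let ?S = "{x :: real^'m. x \<bullet> 1 = 0}"
  have one: "C *v 1 = 0" using null span_base[of 1 "{1}"] by (auto simp: null_space_def)
  have S: "subspace ?S" by (auto simp: subspace_def inner_simps)
  have inv: "C *v x \<in> ?S" for x using symmetric_inner_vec[OF sym, of x 1] one by simp
  \<comment> \<open>Two distinct indices give a nonzero vector orthogonal to 1; here
    \<open>m2\<close> enters.\<close>
  obtain i j :: 'm where ij: "i \<noteq> j"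
    using m2 by (metis One_nat_def Suc_1 card_le_Suc0_iff_eq finite not_less_eq_eq UNIV_I)
  have "(axis i 1 - axis j 1 :: real^'m) \<in> ?S" by (simp add: inner_simps inner_axis')
  moreover have "(axis i 1 - axis j 1 :: real^'m) \<noteq> 0" using ij by (simp add: axis_eq_axis)
  ultimately obtain v \<mu> where v: "v \<in> ?S" "v \<noteq> 0" "C *v v = \<mu> *\<^sub>R v"
    and q: "\<And>x. x \<in> ?S \<Longrightarrow> \<mu> * (x \<bullet> x) \<le> x \<bullet> (C *v x)"
    using rayleigh_minimizer[OF sym S inv] by (metis (no_types, lifting))
  have one_inner: "(1 :: real^'m) \<bullet> 1 = CARD('m)" by (simp add: inner_vec_def)
  have "v \<notin> span {1}"
  proof
    assume "v \<in> span {1}"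
    then obtain c where "v = c *\<^sub>R 1" by (auto simp: span_singleton)
    then show False using v(1,2) one_inner by simp
  qed
  then have "C *v v \<noteq> 0" using null by (auto simp: null_space_def)
  then have "\<mu> \<noteq> 0" using v by auto
  moreover have "0 \<le> v \<bullet> (C *v v)" using psd by (simp add: loewner_le_def)
  then have "\<mu> \<ge> 0" using v by (simp add: zero_le_mult_iff) (metis inner_gt_zero_iff not_le)
  ultimately have \<mu>: "\<mu> > 0" by simp
  have fin: "finite (eigenvalues C)" by (rule finite_eigenvalues[OF sym])
  have zero_ev: "0 \<in> eigenvalues C"
    unfolding eigenvalues_def using one by (auto intro!: exI[of _ 1] simp: vec_eq_iff)
  have \<mu>_ev: "\<mu> \<in> eigenvalues C - {0}" unfolding eigenvalues_def using v \<mu> by auto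
  have ge: "\<mu> \<le> l" if l: "l \<in> eigenvalues C - {0}" for l
  proof -
    obtain w where w: "w \<noteq> 0" "C *v w = l *\<^sub>R w" using l by (auto simp: eigenvalues_def)
    then have "w \<bullet> 1 = 0"
      using symmetric_eigenvectors_orthogonal[OF sym w(2), of 1 0] one l by auto
    then show ?thesis using q[of w] w by simp
  qed
  define M where "M = (\<Sum>l\<in>eigenvalues C - {0}. replicate_mset (dim {v. C *v v = l *\<^sub>R v}) l)"
  have "{v. C *v v = 0 *\<^sub>R v} = span {1}" using null by (simp add: null_space_def)
  then have "dim {v. C *v v = 0 *\<^sub>R v} = 1" by simp
  then have "eigenvalue_mset C = {#0#} + M"
    unfolding eigenvalue_mset_def M_def sum.remove[OF fin zero_ev] by simp
  have dim0: "dim {v. C *v v = l *\<^sub>R v} \<noteq> 0" if "l \<in> eigenvalues C" for l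
    using that by (auto simp: eigenvalues_def)
  have setM: "set_mset M = eigenvalues C - {0}"
    unfolding M_def using fin dim0 by (auto simp: set_mset_sum split: if_splits)
  obtain ys where ys: "sorted_list_of_multiset M = ys" by blast
  have sys: "sorted ys" "set ys = eigenvalues C - {0}"
    unfolding ys[symmetric] setM[symmetric] by simp_all
  then obtain y zs where yz: "ys = y # zs" using \<mu>_ev by (cases ys) auto
  \<comment> \<open>As no entry of \<open>ys\<close> is negative, inserting 0 puts it at the head,
    and list position 1 holds the head of \<open>ys\<close>.\<close>
  have "0 \<le> y" if "y \<in> set ys" for y
    using ge[of y] \<mu> that unfolding sys(2) by linarith
  then have "sorted_list_of_multiset ({#0#} + M) = 0 # ys"
    using ys yz by (simp add: insort_is_Cons)
  then have "lambda2 C = y" unfolding lambda2_def \<open>eigenvalue_mset C = _\<close> using yz by simp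
  also have "y = \<mu>"
  proof (rule antisym)
    have "\<mu> \<in> insert y (set zs)" using \<mu>_ev sys(2) yz by simp
    then show "y \<le> \<mu>" using sys(1) yz by auto
    show "\<mu> \<le> y" using ge[of y] sys(2) yz by auto
  qed
  finally have "lambda2 C = \<mu>" .
  then show "0 < lambda2 C" "x \<bullet> 1 = 0 \<Longrightarrow> lambda2 C * (x \<bullet> x) \<le> x \<bullet> (C *v x)"
    using \<mu> q by auto
qed

text \<open>The range of a symmetric matrix is the orthogonal complement of its kernel, so
  \<open>y\<close> has a preimage. For the preimage orthogonal to 1 the spectral gap gives
  \<open>lambda2 C * norm w \<le> norm y\<close>, and Cauchy-Schwarz finishes. In effect the
  pseudoinverse of \<open>C\<close> is bounded by \<open>1 / lambda2 C\<close>.\<close>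

lemma null_span_one_range:
  fixes C :: "real^'m^'m"
  assumes m2: "CARD('m) \<ge> 2" and sym: "symmetric_matrix C" and psd: "loewner_le 0 C"
    and null: "null_space C = span {1}" and y: "y \<bullet> 1 = 0"
  shows "\<exists>w. C *v w = y \<and> lambda2 C * (w \<bullet> (C *v w)) \<le> y \<bullet> y"
proof -
  have one: "C *v 1 = 0" using null span_base[of 1 "{1}"] by (auto simp: null_space_def)
  have one_inner: "(1 :: real^'m) \<bullet> 1 = CARD('m)" by (simp add: inner_vec_def)
  have "span (range ((*v) C)) = range ((*v) C)"
    by (intro span_eq_iff[THEN iffD2] linear_subspace_image subspace_UNIV matrix_vector_mul_linear)
  then obtain u z where uz: "u \<in> range ((*v) C)" "\<And>x. x \<in> range ((*v) C) \<Longrightarrow> orthogonal z x" "y = u + z"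
    using orthogonal_subspace_decomp_exists[of "range ((*v) C)" y] by metis
  then obtain w0 where w0: "u = C *v w0" by blast
  \<comment> \<open>\<open>z\<close> is orthogonal to the range, so by symmetry the squared norm of
    \<open>C *v z\<close> is the inner product of \<open>z\<close> with a point of the
    range.\<close>
  have "C *v z = 0"
    using uz(2)[of "C *v (C *v z)"] symmetric_inner_vec[OF sym, of z "C *v z"]
    by (simp add: orthogonal_def)
  then have "z \<in> span {1}" using null by (auto simp: null_space_def)
  then obtain c where c: "z = c *\<^sub>R 1" by (auto simp: span_singleton)
  have "u \<bullet> 1 = 0" using symmetric_inner_vec[OF sym, of w0 1] one w0 by simp
  then have "c = 0" using y uz(3) c one_inner by (simp add: inner_add_left)
  \<comment> \<open>Subtracting the mean leaves the image unchanged because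
    \<open>C *v 1 = 0\<close>.\<close>
  define w where "w = w0 - (w0 \<bullet> 1 / CARD('m)) *\<^sub>R 1"
  have Cw: "C *v w = y"
    using uz(3) w0 c \<open>c = 0\<close> one
    by (simp add: w_def matrix_vector_mult_diff_distrib matrix_vector_mult_scaleR)
  have "w \<bullet> 1 = 0" by (simp add: w_def inner_diff_left one_inner)
  from lambda2_null_span_one(2)[OF m2 sym psd null this]
  have "lambda2 C * (norm w)\<^sup>2 \<le> w \<bullet> y" by (simp add: Cw power2_norm_eq_inner)
  also have "\<dots> \<le> norm w * norm y" by (rule norm_cauchy_schwarz)
  finally have le: "lambda2 C * norm w * norm w \<le> norm y * norm w" by (simp add: power2_eq_square mult_ac)
  have "lambda2 C * norm w \<le> norm y"
  proof (cases "w = 0")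
    case False
    then show ?thesis using mult_right_le_imp_le[OF le] by simp
  qed simp
  then have "lambda2 C * norm w * norm y \<le> norm y * norm y" by (rule mult_right_mono) simp
  moreover have "lambda2 C * (w \<bullet> y) \<le> lambda2 C * (norm w * norm y)"
    using lambda2_null_span_one(1)[OF m2 sym psd null]
    by (intro mult_left_mono norm_cauchy_schwarz) simp
  ultimately have "lambda2 C * (w \<bullet> y) \<le> y \<bullet> y" by (simp add: dot_square_norm power2_eq_square mult.assoc)
  then show ?thesis using Cw by blast
qed

text \<open>Each column of \<open>V\<close> is orthogonal to 1, so preimages can be chosen column by
  column. This serves to write a multiplier as an image under \<open>C\<close>.\<close>

lemma null_span_one_range_matrix:
  fixes C :: "real^'m^'m" and V :: "real^'d^'m"
  assumes "CARD('m) \<ge> 2" "symmetric_matrix C" "loewner_le 0 C" "null_space C = span {1}"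
    and V: "(\<Sum>i\<in>UNIV. V $ i) = 0"
  obtains W where "C ** W = V" "lambda2 C * (W \<bullet> V) \<le> V \<bullet> V"
proof -
  have "column c V \<bullet> 1 = 0" for c
    using V by (simp add: inner_vec_def column_def vec_eq_iff)
  then have "\<forall>c. \<exists>w. C *v w = column c V \<and> lambda2 C * (w \<bullet> (C *v w)) \<le> column c V \<bullet> column c V"
    using null_span_one_range[OF assms(1-4)] by blast
  from choice[OF this] obtain w where w: "\<And>c. C *v w c = column c V"
    "\<And>c. lambda2 C * (w c \<bullet> (C *v w c)) \<le> column c V \<bullet> column c V" by blast
  define W :: "real^'d^'m" where "W = (\<chi> i c. w c $ i)"
  have col: "column c W = w c" for c by (simp add: W_def column_def)
  have "column c (C ** W) = column c V" for c by (simp add: column_matrix_mult col w)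
  then have "C ** W = V" by (simp add: column_def vec_eq_iff)
  moreover have "lambda2 C * (W \<bullet> V) \<le> V \<bullet> V"
    unfolding inner_columns sum_distrib_left using w by (intro sum_mono) (simp add: col)
  ultimately show thesis by (rule that)
qed

lemma matrix_diff_rdistrib: "(A - B) ** X = A ** X - B ** (X :: real^'d^'m)"
  by (simp add: matrix_matrix_mult_def vec_eq_iff left_diff_distrib sum_subtractf)

lemma linear_matrix_mult: "linear (\<lambda>X. A ** (X :: real^'d^'m))"
  by (rule linearI) (simp_all add: matrix_add_ldistrib matrix_scalar_ac scalar_matrix_assoc)

lemma matrix_mult_ones_outer:
  assumes "A *v 1 = c *\<^sub>R 1"
  shows "A ** ones_outer x = c *\<^sub>R (ones_outer x :: real^'d^'m)"
  using assms by (simp add: ones_outer_def matrix_matrix_mult_def matrix_vector_mult_def vec_eq_iff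
      sum_distrib_right[symmetric])

text \<open>The matrix \<open>I - C / 2 - D\<close> is positive semidefinite and its form at 1 is
  \<open>m - 0 - m = 0\<close>, so 1 lies in its kernel.\<close>

lemma mixing_matrix_fixes_ones:
  fixes C D :: "real^'m^'m"
  assumes "symmetric_matrix C" "symmetric_matrix D" and C1: "C *v 1 = 0"
    and D_ones: "1 \<bullet> (D *v 1) = real CARD('m)"
    and D_le: "loewner_le D (mat 1 - (1/2) *\<^sub>R C)"
  shows "D *v 1 = 1"
proof -
  define B where "B = mat 1 - (1/2) *\<^sub>R C - D"
  have B: "B *v 1 = 1 - D *v 1"
    by (simp add: B_def matrix_vector_mult_diff_rdistrib scaleR_matrix_vector_assoc[symmetric] C1)
  have "B *v 1 = 0"
  proof (rule psd_form_zero_imp_null[OF _ subspace_UNIV])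
    show "symmetric_matrix B"
      using assms(1,2) by (simp add: symmetric_matrix_def B_def transpose_def vec_eq_iff mat_def)
    show "0 \<le> x \<bullet> (B *v x)" for x using D_le by (simp add: loewner_le_def B_def)
    have "(1 :: real^'m) \<bullet> 1 = CARD('m)" by (simp add: inner_vec_def)
    then show "1 \<bullet> (B *v 1) = 0" unfolding B inner_diff_right using D_ones by simp
  qed auto
  then show ?thesis by (simp add: B)
qed

section \<open>Smooth convex functions and the proximal map\<close>

text \<open>\<open>grad\<close> is a definite description, so existence and uniqueness are both
  required. The Riesz representative, built from the derivative on the basis, gives
  existence.\<close>

lemma GDERIV_grad:
  fixes f :: "'a::euclidean_space \<Rightarrow> real"
  assumes "f differentiable (at x)"
  shows "GDERIV f x :> grad f x"
proof -
  obtain f' where f': "(f has_derivative f') (at x)" using assms by (auto simp: differentiable_def)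
  define D where "D = (\<Sum>b\<in>Basis. f' b *\<^sub>R b)"
  have "f' = (\<lambda>h. h \<bullet> D)"
  proof
    fix h
    interpret f': linear f' using f' by (rule has_derivative_linear)
    have "f' h = f' (\<Sum>b\<in>Basis. (h \<bullet> b) *\<^sub>R b)" by (simp add: euclidean_representation)
    also have "\<dots> = h \<bullet> D"
      by (simp add: f'.sum f'.scale D_def inner_sum_right mult.commute)
    finally show "f' h = h \<bullet> D" .
  qed
  then have D: "GDERIV f x :> D" using f' by (simp add: gderiv_def)
  have "E = D" if "GDERIV f x :> E" for E
  proof -
    have "(\<lambda>h. h \<bullet> E) = (\<lambda>h. h \<bullet> D)"
      using that D unfolding gderiv_def by (rule has_derivative_unique)
    then show ?thesis by (metis vector_eq_ldot)
  qed
  then show ?thesis unfolding grad_def using D by (rule theI[where a = D, rotated])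
qed

lemma GDERIV_grad_unique:
  fixes f :: "'a::euclidean_space \<Rightarrow> real"
  assumes "GDERIV f x :> D"
  shows "grad f x = D"
proof -
  have "f differentiable (at x)" using assms by (auto simp: gderiv_def differentiable_def)
  from GDERIV_grad[OF this] assms have "(\<lambda>h. h \<bullet> grad f x) = (\<lambda>h. h \<bullet> D)"
    unfolding gderiv_def by (rule has_derivative_unique)
  then show ?thesis by (metis vector_eq_ldot)
qed

lemma GDERIV_line:
  assumes "GDERIV f (x + t *\<^sub>R d) :> D"
  shows "((\<lambda>t. f (x + t *\<^sub>R d)) has_real_derivative D \<bullet> d) (at t)"
proof -
  have "((\<lambda>t. x + t *\<^sub>R d) has_derivative (\<lambda>s. s *\<^sub>R d)) (at t)"
    by (rule derivative_eq_intros refl | simp)+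
  from has_derivative_compose[OF this assms[unfolded gderiv_def]]
  have "((\<lambda>t. f (x + t *\<^sub>R d)) has_derivative (\<lambda>s. (s *\<^sub>R d) \<bullet> D)) (at t)" .
  moreover have "(\<lambda>s. (s *\<^sub>R d) \<bullet> D) = (*) (D \<bullet> d)" by (auto simp: inner_commute)
  ultimately show ?thesis by (simp add: has_field_derivative_def)
qed

lemma convex_gradient_ineq:
  fixes f :: "'a::real_inner \<Rightarrow> real"
  assumes conv: "convex_on UNIV f" and D: "GDERIV f x :> D"
  shows "f x + D \<bullet> (y - x) \<le> f y"
proof -
  let ?h = "\<lambda>t. f (x + t *\<^sub>R (y - x))"
  have "convex_on UNIV ?h"
  proof (rule convex_onI)
    fix t a b :: real assume t: "0 < t" "t < 1"
    have "x + ((1 - t) *\<^sub>R a + t *\<^sub>R b) *\<^sub>R (y - x)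
        = (1 - t) *\<^sub>R (x + a *\<^sub>R (y - x)) + t *\<^sub>R (x + b *\<^sub>R (y - x))"
      by (simp add: algebra_simps)
    then show "?h ((1 - t) *\<^sub>R a + t *\<^sub>R b) \<le> (1 - t) * ?h a + t * ?h b"
      using convex_onD[OF conv, of t] t by simp
  qed simp
  moreover have "(?h has_real_derivative D \<bullet> (y - x)) (at 0)"
    using D by (intro GDERIV_line) simp
  ultimately have "?h 1 - ?h 0 \<ge> (D \<bullet> (y - x)) * (1 - 0)"
    by (intro convex_on_imp_above_tangent[where A = UNIV]) auto
  then show ?thesis by simp
qed

text \<open>Subtracting the linear and quadratic terms along the segment leaves a function whose
  derivative is nonpositive, by Cauchy-Schwarz and the Lipschitz gradient. Its values at 0 and 1
  give the bound.\<close>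

lemma L_smooth_descent:
  fixes f :: "'a::euclidean_space \<Rightarrow> real"
  assumes "L_smooth L f"
  shows "f y \<le> f x + grad f x \<bullet> (y - x) + L / 2 * (norm (y - x))\<^sup>2"
proof -
  let ?d = "y - x"
  let ?h = "\<lambda>t. f (x + t *\<^sub>R ?d) - t * (grad f x \<bullet> ?d) - L / 2 * t\<^sup>2 * (norm ?d)\<^sup>2"
  have "\<exists>s. (?h has_real_derivative s) (at t) \<and> s \<le> 0" if "0 \<le> t" for t
  proof (intro exI conjI)
    let ?z = "x + t *\<^sub>R ?d"
    have "GDERIV f ?z :> grad f ?z" using assms by (auto simp: L_smooth_def intro: GDERIV_grad)
    from GDERIV_line[OF this]
    show "(?h has_real_derivative grad f ?z \<bullet> ?d - grad f x \<bullet> ?d - L * t * (norm ?d)\<^sup>2) (at t)"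
      by (auto intro!: derivative_eq_intros)
    have "(grad f ?z - grad f x) \<bullet> ?d \<le> norm (grad f ?z - grad f x) * norm ?d"
      by (rule norm_cauchy_schwarz)
    also have "norm (grad f ?z - grad f x) * norm ?d \<le> L * dist ?z x * norm ?d"
    proof (rule mult_right_mono)
      show "norm (grad f ?z - grad f x) \<le> L * dist ?z x"
        using assms lipschitz_onD[of L UNIV "grad f" ?z x] unfolding L_smooth_def dist_norm by blast
    qed simp
    also have "\<dots> = L * t * (norm ?d)\<^sup>2"
      using that by (simp add: dist_norm power2_eq_square)
    finally show "grad f ?z \<bullet> ?d - grad f x \<bullet> ?d - L * t * (norm ?d)\<^sup>2 \<le> 0"
      by (simp add: inner_diff_left)
  qed
  then have "?h 1 \<le> ?h 0" by (intro DERIV_nonpos_imp_nonincreasing[of 0 1 ?h]) auto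
  then show ?thesis by simp
qed

section \<open>Extended-valued convex functions and proximal steps\<close>

lemma convex_fun_jensen:
  fixes G :: "'a::real_vector \<Rightarrow> ereal"
  assumes "convex_fun G" "finite S" "sum a S = 1"
    and "\<And>i. i \<in> S \<Longrightarrow> 0 \<le> a i" and "\<And>i. i \<in> S \<Longrightarrow> G (y i) \<le> ereal (r i)"
  shows "G (\<Sum>i\<in>S. a i *\<^sub>R y i) \<le> ereal (\<Sum>i\<in>S. a i * r i)"
proof -
  have "(\<Sum>i\<in>S. a i *\<^sub>R (y i, r i)) \<in> ereal_epigraph G"
    using assms by (intro convex_sum) (auto simp: convex_fun_def ereal_epigraph_def)
  then show ?thesis by (simp add: ereal_epigraph_def scaleR_prod_def sum_prod)
qed

text \<open>The affine minorant given by a single subgradient makes the proximal objective coercive,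
  so its sublevel sets in the epigraph are compact.\<close>

lemma prox_objective_attains_min:
  fixes G :: "'a::euclidean_space \<Rightarrow> ereal"
  assumes closed: "closed_fun G" and a: "G x = ereal a" and \<xi>: "\<xi> \<in> subdifferential G x" and c: "c > 0"
  obtains p where "\<And>y. G p + ereal (c * (norm (u - p))\<^sup>2) \<le> G y + ereal (c * (norm (u - y))\<^sup>2)"
proof -
  have minor: "ereal (a + \<xi> \<bullet> (y - x)) \<le> G y" for y
    using \<xi> a by (auto simp: subdifferential_def)
  \<comment> \<open>\<open>M\<close> is the objective at \<open>x\<close>, so \<open>S\<close>
    contains \<open>(x, a)\<close>. On \<open>S\<close> the distance \<open>s\<close> to
    \<open>u\<close> satisfies \<open>c * s^2 \<le> K + norm \<xi> * s\<close>, hence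
    \<open>s \<le> R\<close>; \<open>lo\<close> bounds the affine minorant from below on that
    ball.\<close>
  define M where "M = a + c * (norm (u - x))\<^sup>2"
  define S where "S = ereal_epigraph G \<inter> {q. snd q + c * (norm (u - fst q))\<^sup>2 \<le> M}"
  define K where "K = \<bar>M - a - \<xi> \<bullet> (u - x)\<bar>"
  define R where "R = 1 + (K + norm \<xi>) / c"
  define lo where "lo = a - norm \<xi> * (R + norm (u - x))"
  have R: "1 \<le> R" unfolding R_def K_def using c by simp
  have "S \<subseteq> cball u R \<times> {lo..M}"
  proof (clarsimp simp: S_def ereal_epigraph_def, intro conjI)
    fix y r assume y: "G y \<le> ereal r" and M: "r + c * (norm (u - y))\<^sup>2 \<le> M"
    have r: "a + \<xi> \<bullet> (y - x) \<le> r" using minor[of y] y order_trans by fastforce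
    have split: "\<xi> \<bullet> (y - x) = \<xi> \<bullet> (y - u) + \<xi> \<bullet> (u - x)" by (simp add: inner_simps)
    have cs: "\<bar>\<xi> \<bullet> (y - u)\<bar> \<le> norm \<xi> * norm (u - y)"
      using Cauchy_Schwarz_ineq2[of \<xi> "y - u"] by (simp add: norm_minus_commute)
    have ub: "c * (norm (u - y))\<^sup>2 \<le> K + norm \<xi> * norm (u - y)"
      using r M split cs unfolding K_def by linarith
    show d: "dist u y \<le> R"
    proof (cases "norm (u - y) \<le> 1")
      case False
      have "K \<le> K * norm (u - y)" using False mult_left_mono[of 1 "norm (u - y)" K] by (simp add: K_def)
      then have "c * norm (u - y) * norm (u - y) \<le> (K + norm \<xi>) * norm (u - y)"
        using ub by (simp add: power2_eq_square algebra_simps)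
      then have "c * norm (u - y) \<le> K + norm \<xi>"
        by (rule mult_right_le_imp_le) (use False in linarith)
      then show ?thesis using c by (simp add: R_def dist_norm field_simps)
    qed (use R in \<open>simp add: dist_norm\<close>)
    have "- (\<xi> \<bullet> (u - x)) \<le> norm \<xi> * norm (u - x)"
      using Cauchy_Schwarz_ineq2[of \<xi> "u - x"] by linarith
    moreover have "norm \<xi> * norm (u - y) \<le> norm \<xi> * R"
      using d by (intro mult_left_mono) (auto simp: dist_norm)
    ultimately show "lo \<le> r" unfolding lo_def using r split cs by (simp add: algebra_simps)
    have "0 \<le> c * (norm (u - y))\<^sup>2" using c by simp
    then show "r \<le> M" using M by linarith
  qed
  then have "bounded S" by (rule bounded_subset[rotated]) (intro bounded_Times bounded_cball bounded_closed_interval)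
  moreover have "closed S"
    unfolding S_def using closed
    by (intro closed_Int closed_Collect_le continuous_intros) (simp add: closed_fun_def)
  ultimately have "compact S" by (simp add: compact_eq_bounded_closed)
  moreover have xa: "(x, a) \<in> S" by (simp add: S_def ereal_epigraph_def a M_def)
  moreover have "continuous_on S (\<lambda>q. snd q + c * (norm (u - fst q))\<^sup>2)" by (intro continuous_intros)
  ultimately obtain q where q: "q \<in> S"
    and min: "\<And>z. z \<in> S \<Longrightarrow> snd q + c * (norm (u - fst q))\<^sup>2 \<le> snd z + c * (norm (u - fst z))\<^sup>2"
    using continuous_attains_inf[of S "\<lambda>q. snd q + c * (norm (u - fst q))\<^sup>2"] by blast
  show thesis
  proof (rule that)
    fix y
    have "G (fst q) \<le> ereal (snd q)" using q by (auto simp: S_def ereal_epigraph_def)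
    then have "G (fst q) + ereal (c * (norm (u - fst q))\<^sup>2) \<le> ereal (snd q + c * (norm (u - fst q))\<^sup>2)"
      by (metis add_right_mono plus_ereal.simps(1))
    also have "\<dots> \<le> G y + ereal (c * (norm (u - y))\<^sup>2)"
    \<comment> \<open>A finite value either gives a point of \<open>S\<close> or an objective above
      \<open>M\<close>, which \<open>(x, a)\<close> already attains.\<close>
    proof (cases "G y")
      case (real s)
      show ?thesis
      proof (cases "(y, s) \<in> S")
        case True
        then show ?thesis using min[OF True] real by simp
      next
        case False
        then have "M < s + c * (norm (u - y))\<^sup>2" using real by (auto simp: S_def ereal_epigraph_def)
        then show ?thesis using min[OF xa] real by (simp add: M_def)
      qed
    qed (use minor[of y] in auto)
    finally show "G (fst q) + ereal (c * (norm (u - fst q))\<^sup>2) \<le> G y + ereal (c * (norm (u - y))\<^sup>2)" .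
  qed
qed

text \<open>On the segment from \<open>p\<close> to \<open>y\<close>, convexity bounds
  \<open>G\<close> by a function affine in \<open>t\<close>, while the squared distance is quadratic
  in \<open>t\<close>. Dividing the minimality inequality by \<open>t\<close> and letting
  \<open>t\<close> tend to 0 removes the quadratic term.\<close>

lemma prox_objective_min_subgradient:
  fixes G :: "'a::real_inner \<Rightarrow> ereal"
  assumes conv: "convex_fun G" and a: "G p = ereal a" and c: "c > 0"
    and min: "\<And>y. G p + ereal (c * (norm (u - p))\<^sup>2) \<le> G y + ereal (c * (norm (u - y))\<^sup>2)"
  shows "(2 * c) *\<^sub>R (u - p) \<in> subdifferential G p"
  unfolding subdifferential_def
proof (intro CollectI allI)
  fix y
  show "G p + ereal ((2 * c) *\<^sub>R (u - p) \<bullet> (y - p)) \<le> G y"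
  proof (cases "G y")
    case (real s)
    have "a + 2 * c * ((u - p) \<bullet> (y - p)) \<le> s + t * (c * (norm (y - p))\<^sup>2)" if t: "0 < t" "t < 1" for t
    proof -
      let ?z = "p + t *\<^sub>R (y - p)"
      have "(1 - t) *\<^sub>R (p, a) + t *\<^sub>R (y, s) \<in> ereal_epigraph G"
        using conv t by (intro convexD_alt) (auto simp: convex_fun_def ereal_epigraph_def a real)
      moreover have "(1 - t) *\<^sub>R (p, a) + t *\<^sub>R (y, s) = (?z, a + t * (s - a))"
        by (simp add: algebra_simps)
      ultimately have "G ?z \<le> ereal (a + t * (s - a))" by (simp add: ereal_epigraph_def)
      then have "G ?z + ereal (c * (norm (u - ?z))\<^sup>2)
          \<le> ereal (a + t * (s - a)) + ereal (c * (norm (u - ?z))\<^sup>2)"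
        by (rule add_right_mono)
      from order_trans[OF min this]
      have le: "a + c * (norm (u - p))\<^sup>2 \<le> a + t * (s - a) + c * (norm (u - ?z))\<^sup>2"
        by (simp add: a)
      define e N where "e = (u - p) \<bullet> (y - p)" and "N = (norm (y - p))\<^sup>2"
      have "(norm (u - ?z))\<^sup>2 = (norm (u - p))\<^sup>2 - 2 * t * e + t\<^sup>2 * N"
        unfolding diff_diff_eq[symmetric] power2_norm_eq_inner e_def N_def
        by (simp add: inner_diff_left inner_diff_right inner_commute algebra_simps power2_eq_square)
      from le[unfolded this] have "t * (a + 2 * c * e) \<le> t * (s + t * (c * N))"
        by (simp add: algebra_simps power2_eq_square)
      then have "a + 2 * c * e \<le> s + t * (c * N)" using t by simp
      then show ?thesis by (simp add: e_def N_def)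
    qed
    then have "eventually (\<lambda>t. a + 2 * c * ((u - p) \<bullet> (y - p)) \<le> s + t * (c * (norm (y - p))\<^sup>2)) (at_right 0)"
      unfolding eventually_at_right_field by (intro exI[of _ 1]) auto
    moreover have "((\<lambda>t. s + t * (c * (norm (y - p))\<^sup>2)) \<longlongrightarrow> s + 0 * (c * (norm (y - p))\<^sup>2)) (at_right 0)"
      by (intro tendsto_intros)
    ultimately have "a + 2 * c * ((u - p) \<bullet> (y - p)) \<le> s + 0 * (c * (norm (y - p))\<^sup>2)"
      by (intro tendsto_lowerbound[OF _ _ trivial_limit_at_right_real])
    then show ?thesis by (simp add: a real)
  qed (use min[of y] a in auto)
qed

text \<open>The objective separates over rows. Row minimizers assemble to a minimizer of the whole,
  and conversely each row of the chosen minimizer attains its row minimum, so the one-row optimality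
  condition applies.\<close>

lemma prox_g_sum_subgradient:
  fixes G :: "real^'d \<Rightarrow> ereal" and U :: "real^'d^'m"
  assumes closed: "closed_fun G" and conv: "convex_fun G"
    and a: "G x = ereal a" and \<xi>: "\<xi> \<in> subdifferential G x" and \<gamma>: "\<gamma> > 0"
  defines "P \<equiv> prox \<gamma> (g_sum G) U"
  shows "\<exists>r. G (P $ i) = ereal r" and "(1 / \<gamma>) *\<^sub>R (U $ i - P $ i) \<in> subdifferential G (P $ i)"
proof -
  define c where "c = 1 / (2 * \<gamma>)"
  have c: "c > 0" using \<gamma> by (simp add: c_def)
  define H where "H i y = G y + ereal (c * (norm (U $ i - y))\<^sup>2)" for i y
  define h where "h Y = g_sum G Y + ereal (c * (norm (U - Y))\<^sup>2)" for Y :: "real^'d^'m"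
  have minor: "ereal (a + \<xi> \<bullet> (y - x)) \<le> G y" for y
    using \<xi> a by (auto simp: subdifferential_def)
  have h: "h Y = (\<Sum>i\<in>UNIV. H i (Y $ i))" for Y
    unfolding h_def H_def g_sum_def sum.distrib sum_ereal power2_norm_eq_inner
    by (simp add: inner_vec_def sum_distrib_left)
  have "\<forall>i. \<exists>p. \<forall>y. H i p \<le> H i y"
    unfolding H_def using prox_objective_attains_min[OF closed a \<xi> c] by metis
  then obtain p where p: "\<And>i y. H i (p i) \<le> H i y" by metis
  have "h (\<chi> i. p i) \<le> h Y" for Y unfolding h by (intro sum_mono) (simp add: p)
  then have "is_arg_min h (\<lambda>_. True) (\<chi> i. p i)" by (simp add: is_arg_min_linorder)
  \<comment> \<open>\<open>prox\<close> is a choice among minimizers, so it is known to minimize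
    only once a minimizer has been exhibited.\<close>
  then have "is_arg_min h (\<lambda>_. True) P"
    unfolding P_def prox_def arg_min_def h_def c_def by (rule someI)
  then have hP: "h P \<le> h Y" for Y by (simp add: is_arg_min_linorder)
  \<comment> \<open>The value at \<open>x\<close> bounds the row minimum from above and the affine
    minorant excludes \<open>-\<infinity>\<close>; finiteness permits termwise comparison of real
    sums below.\<close>
  have finp: "\<bar>H j (p j)\<bar> \<noteq> \<infinity>" for j
  proof -
    have "H j (p j) \<le> H j x" by (rule p)
    moreover have "H j (p j) \<noteq> -\<infinity>" using minor[of "p j"] by (auto simp: H_def)
    ultimately show ?thesis by (auto simp: H_def a)
  qed
  have finP: "\<bar>H j (P $ j)\<bar> \<noteq> \<infinity>" for j
  proof -
    have "h P \<le> h (\<chi> i. x)" by (rule hP)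
    then have "h P \<noteq> \<infinity>" by (auto simp: h H_def a)
    then have "H j (P $ j) \<noteq> \<infinity>" by (auto simp: h sum_Pinfty)
    moreover have "H j (P $ j) \<noteq> -\<infinity>" using minor[of "P $ j"] by (auto simp: H_def)
    ultimately show ?thesis by auto
  qed
  have "H i (P $ i) = H i (p i)"
  proof -
    let ?a = "\<lambda>j. real_of_ereal (H j (p j))" and ?b = "\<lambda>j. real_of_ereal (H j (P $ j))"
    have "(\<Sum>j\<in>UNIV. ereal (?b j)) \<le> (\<Sum>j\<in>UNIV. ereal (?a j))"
      using hP[of "\<chi> i. p i"] finp finP by (simp add: h ereal_real' del: sum_ereal)
    then have le: "sum ?b UNIV \<le> sum ?a UNIV" by simp
    have "ereal (?a j) \<le> ereal (?b j)" for j
      using p[of j "P $ j"] finp[of j] finP[of j] by (simp add: ereal_real' del: ereal_less_eq)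
    then have ab: "?a j \<le> ?b j" for j by simp
    have "sum ?a UNIV = sum ?b UNIV" by (rule antisym[OF sum_mono[OF ab] le])
    then have "?a i = ?b i" using ab by (rule sum_mono_inv) auto
    then show ?thesis using finp finP by (metis ereal_real')
  qed
  then have min: "H i (P $ i) \<le> H i y" for y using p by simp
  show r: "\<exists>r. G (P $ i) = ereal r"
    using finP[of i] unfolding H_def by (cases "G (P $ i)") auto
  then obtain r where "G (P $ i) = ereal r" ..
  from prox_objective_min_subgradient[OF conv this c, of "U $ i"] min
  show "(1 / \<gamma>) *\<^sub>R (U $ i - P $ i) \<in> subdifferential G (P $ i)"
    by (simp add: H_def c_def)
qed

section \<open>The primal-dual iteration\<close>

text \<open>\<open>P\<close> stands for the gradient plus the proximal subgradient, and
  \<open>Z\<close> for the running sum of iterates. After expansion, \<open>D_ge\<close> absorbs the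
  smoothness term and \<open>D_le\<close> the remaining squares of the new error.\<close>

lemma primal_dual_step:
  fixes C D :: "real^'m^'m" and X X' Z W Xs P :: "real^'d^'m"
  assumes C: "symmetric_matrix C" and D: "symmetric_matrix D"
    and D_le: "loewner_le D (mat 1 - (1/2) *\<^sub>R C)"
    and D_ge: "\<And>x. \<gamma> * L * (x \<bullet> x) \<le> x \<bullet> (D *v x)"
    and Xs: "D ** Xs = Xs" "C ** Xs = 0"
    and step: "\<gamma> *\<^sub>R P = D ** X - X' - C ** Z" and \<gamma>: "\<gamma> > 0"
  shows "P \<bullet> (X' - Xs) + L / 2 * (norm (X' - X))\<^sup>2 + (1 / \<gamma>) * ((C ** W) \<bullet> X')
    \<le> 1 / (2 * \<gamma>) * ((X - Xs) \<bullet> (D ** (X - Xs)) - (X' - Xs) \<bullet> (D ** (X' - Xs))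
        + ((Z - W) \<bullet> (C ** (Z - W)) - (Z + X' - W) \<bullet> (C ** (Z + X' - W))))"
proof -
  define e e' T where "e = X - Xs" and "e' = X' - Xs" and "T = Z - W"
  note distrib = linear_add[OF linear_matrix_mult] linear_diff[OF linear_matrix_mult]
  have X: "X = e + Xs" "X' = e' + Xs" "Z = T + W" "Z + X' - W = T + X'"
    by (simp_all add: e_def e'_def T_def)
  have CX': "C ** X' = C ** e'" by (simp add: X distrib Xs)
  have Xs_C: "(C ** V) \<bullet> Xs = 0" for V by (simp add: symmetric_inner_matrix[OF C] Xs)
  have "\<gamma> *\<^sub>R P = D ** e - e' - C ** T - C ** W"
    unfolding step by (simp add: X distrib Xs)
  then have P: "\<gamma> * (P \<bullet> e') = (D ** e) \<bullet> e' - e' \<bullet> e' - (C ** T) \<bullet> e' - (C ** W) \<bullet> e'"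
    by (metis inner_diff_left inner_scaleR_left)
  have W: "(C ** W) \<bullet> X' = (C ** W) \<bullet> e'" by (simp add: X inner_add_right Xs_C)
  have T: "(T + X') \<bullet> (C ** (T + X')) = T \<bullet> (C ** T) + 2 * ((C ** T) \<bullet> e') + e' \<bullet> (C ** e')"
  proof -
    have "X' \<bullet> (C ** Q) = e' \<bullet> (C ** Q)" for Q
      using Xs_C[of Q] by (simp add: X inner_add_left inner_add_right inner_commute)
    then show ?thesis
      using symmetric_inner_matrix[OF C, of T e']
      by (simp add: distrib CX' inner_add_left inner_add_right inner_commute)
  qed
  have "X' - X = e' - e" by (simp add: X)
  then have nrm: "\<gamma> * L * (norm (X' - X))\<^sup>2 \<le> (e' - e) \<bullet> (D ** (e' - e))"
    using quadratic_form_lower_bound_columns[OF D_ge] by (simp add: power2_norm_eq_inner)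
  also have "\<dots> = e' \<bullet> (D ** e') + e \<bullet> (D ** e) - 2 * ((D ** e) \<bullet> e')"
    using symmetric_inner_matrix[OF D, of e e']
    by (simp add: distrib inner_diff_left inner_diff_right inner_commute)
  finally have E: "\<gamma> * L * (norm (X' - X))\<^sup>2 \<le> e' \<bullet> (D ** e') + e \<bullet> (D ** e) - 2 * ((D ** e) \<bullet> e')" .
  \<comment> \<open>Twice the form of \<open>I - C / 2 - D\<close>: the term
    \<open>- 2 * (e' \<bullet> e')\<close> from \<open>P\<close> pays for the \<open>C\<close> form
    of \<open>e'\<close> in \<open>T\<close> and for two copies of its \<open>D\<close>
    form.\<close>
  have "0 * (e' \<bullet> e') \<le> e' \<bullet> ((mat 1 - (1/2) *\<^sub>R C - D) ** e')"
    using D_le by (intro quadratic_form_lower_bound_columns) (simp add: loewner_le_def)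
  then have F: "0 \<le> 2 * (e' \<bullet> e') - e' \<bullet> (C ** e') - 2 * (e' \<bullet> (D ** e'))"
    by (simp add: matrix_diff_rdistrib scalar_matrix_assoc[symmetric] inner_diff_right)
  have "2 * (\<gamma> * (P \<bullet> e')) + \<gamma> * L * (norm (X' - X))\<^sup>2 + 2 * ((C ** W) \<bullet> X')
      \<le> e \<bullet> (D ** e) - e' \<bullet> (D ** e') + (T \<bullet> (C ** T) - (T + X') \<bullet> (C ** (T + X')))"
    using P W T E F by linarith
  then have "1 / (2 * \<gamma>) * (2 * (\<gamma> * (P \<bullet> e')) + \<gamma> * L * (norm (X' - X))\<^sup>2 + 2 * ((C ** W) \<bullet> X'))
      \<le> 1 / (2 * \<gamma>) * (e \<bullet> (D ** e) - e' \<bullet> (D ** e') + (T \<bullet> (C ** T) - (T + X') \<bullet> (C ** (T + X'))))"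
    using \<gamma> by (intro mult_left_mono) auto
  moreover have "1 / (2 * \<gamma>) * (2 * (\<gamma> * (P \<bullet> e')) + \<gamma> * L * (norm (X' - X))\<^sup>2 + 2 * ((C ** W) \<bullet> X'))
      = P \<bullet> e' + L / 2 * (norm (X' - X))\<^sup>2 + (1 / \<gamma>) * ((C ** W) \<bullet> X')"
    using \<gamma> by (simp add: field_simps)
  ultimately show ?thesis unfolding X(4) T_def[symmetric] e_def[symmetric] e'_def[symmetric] by simp
qed

text \<open>The descent lemma goes from \<open>X\<close> to \<open>X'\<close> and convexity at
  \<open>X\<close> compares with \<open>V\<close>. Adding them cancels the value at \<open>X\<close>
  and leaves the gradient at the old iterate, the one the iteration uses.\<close>

lemma f_sum_descent:
  assumes "\<And>i. convex_on UNIV (f i)" and smooth: "\<And>i. L_smooth L (f i)"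
  shows "f_sum f X' - f_sum f V \<le> grad_rows f X \<bullet> (X' - V) + L / 2 * (norm (X' - X))\<^sup>2"
proof -
  have "f i (X' $ i) - f i (V $ i)
      \<le> grad (f i) (X $ i) \<bullet> (X' $ i - V $ i) + L / 2 * ((X' $ i - X $ i) \<bullet> (X' $ i - X $ i))" for i
  proof -
    have "GDERIV (f i) (X $ i) :> grad (f i) (X $ i)"
      using smooth by (auto simp: L_smooth_def intro: GDERIV_grad)
    from convex_gradient_ineq[OF assms(1) this, of "V $ i"] L_smooth_descent[OF smooth, of i "X' $ i" "X $ i"]
    show ?thesis by (simp add: inner_diff_right power2_norm_eq_inner)
  qed
  then have "(\<Sum>i\<in>UNIV. f i (X' $ i) - f i (V $ i))
      \<le> (\<Sum>i\<in>UNIV. grad (f i) (X $ i) \<bullet> (X' $ i - V $ i) + L / 2 * ((X' $ i - X $ i) \<bullet> (X' $ i - X $ i)))"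
    by (intro sum_mono)
  then show ?thesis
    by (simp add: f_sum_def grad_rows_def power2_norm_eq_inner inner_vec_def sum.distrib sum_subtractf
        sum_distrib_left)
qed

lemma f_sum_gradient_ineq:
  assumes "\<And>i. convex_on UNIV (f i)" and smooth: "\<And>i. L_smooth L (f i)"
  shows "f_sum f V + grad_rows f V \<bullet> (X - V) \<le> f_sum f X"
proof -
  have "f i (V $ i) + grad (f i) (V $ i) \<bullet> (X $ i - V $ i) \<le> f i (X $ i)" for i
    using smooth by (intro convex_gradient_ineq assms(1) GDERIV_grad) (simp add: L_smooth_def)
  then have "(\<Sum>i\<in>UNIV. f i (V $ i) + grad (f i) (V $ i) \<bullet> (X $ i - V $ i)) \<le> (\<Sum>i\<in>UNIV. f i (X $ i))"
    by (intro sum_mono)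
  then show ?thesis by (simp add: f_sum_def grad_rows_def inner_vec_def sum.distrib)
qed

lemma grad_f_avg:
  fixes f :: "'m::finite \<Rightarrow> real^'d \<Rightarrow> real"
  assumes "\<And>i. f i differentiable (at x)"
  shows "grad (f_avg f) x = (1 / CARD('m)) *\<^sub>R (\<Sum>i\<in>UNIV. grad (f i) x)"
proof (rule GDERIV_grad_unique)
  have "(f i has_derivative (\<lambda>h. h \<bullet> grad (f i) x)) (at x)" for i
    using GDERIV_grad[OF assms] by (simp add: gderiv_def)
  then have "(f_avg f has_derivative (\<lambda>h. 1 / CARD('m) * (\<Sum>i\<in>UNIV. h \<bullet> grad (f i) x))) (at x)"
    unfolding f_avg_def[abs_def] by (intro has_derivative_mult_right has_derivative_sum)
  then show "GDERIV (f_avg f) x :> (1 / CARD('m)) *\<^sub>R (\<Sum>i\<in>UNIV. grad (f i) x)"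
    by (simp add: gderiv_def inner_sum_right)
qed

section \<open>Averaged iterates and the merit function\<close>

lemma convex_on_fun_avg:
  fixes x :: "nat \<Rightarrow> 'a::real_vector"
  assumes "convex_on UNIV h" "k \<ge> 1"
  shows "h ((1 / real k) *\<^sub>R (\<Sum>t=1..k. x t)) \<le> (1 / real k) * (\<Sum>t=1..k. h (x t))"
  unfolding scaleR_sum_right sum_distrib_left
  using assms by (intro convex_on_sum[where C = UNIV]) auto

lemma convex_fun_avg:
  fixes x :: "nat \<Rightarrow> 'a::real_vector"
  assumes "convex_fun G" "k \<ge> 1" "\<And>t. t \<in> {1..k} \<Longrightarrow> G (x t) = ereal (r t)"
  shows "G ((1 / real k) *\<^sub>R (\<Sum>t=1..k. x t)) \<le> ereal ((1 / real k) * (\<Sum>t=1..k. r t))"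
  unfolding scaleR_sum_right sum_distrib_left
  using assms by (intro convex_fun_jensen) auto

text \<open>Writing \<open>V\<close> as \<open>C ** W / \<gamma>\<close> makes the linear term part
  of a telescoping potential, of which only the initial value survives. As \<open>Z 0 = 0\<close>,
  this is the \<open>D\<close> form of the initial error plus the \<open>C\<close> form of
  \<open>W\<close>, and \<open>lambda2 C\<close> controls the latter.\<close>

lemma ergodic_gap_bound:
  fixes f :: "'m::finite \<Rightarrow> real^'d \<Rightarrow> real" and G :: "real^'d \<Rightarrow> ereal"
    and C D :: "real^'m^'m" and X U Y :: "nat \<Rightarrow> real^'d^'m" and V :: "real^'d^'m"
  assumes m2: "CARD('m) \<ge> 2"
    and f_convex: "\<And>i. convex_on UNIV (f i)" and f_smooth: "\<And>i. L_smooth L (f i)"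
    and G_closed: "closed_fun G" and G_convex: "convex_fun G"
    and a: "G xs = ereal a" and \<xi>: "\<xi> \<in> subdifferential G xs"
    and C_sym: "symmetric_matrix C" and D_sym: "symmetric_matrix D"
    and D_ones: "1 \<bullet> (D *v 1) = real CARD('m)"
    and C_psd: "loewner_le 0 C" and C_null: "null_space C = span {1}"
    and D_pos: "loewner_less 0 D" and D_le: "loewner_le D (mat 1 - (1/2) *\<^sub>R C)"
    and Y0: "Y 0 = 0"
    and U_step: "\<And>k. U (Suc k) = D ** X k - \<gamma> *\<^sub>R (grad_rows f (X k) + Y k)"
    and X_step: "\<And>k. X (Suc k) = prox \<gamma> (g_sum G) (U (Suc k))"
    and Y_step: "\<And>k. Y (Suc k) = Y k + (1 / \<gamma>) *\<^sub>R (C ** X (Suc k))"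
    and \<gamma>: "\<gamma> > 0" and \<gamma>_le: "\<gamma> * L \<le> lambda_min D"
    and k: "k \<ge> 1"
  defines "Xh \<equiv> (1 / real k) *\<^sub>R (\<Sum>t=1..k. X t)"
  shows "\<exists>s. G (Xh $ i) = ereal s"
    and "(\<Sum>i\<in>UNIV. V $ i) = 0 \<Longrightarrow>
      f_sum f Xh + (\<Sum>i\<in>UNIV. real_of_ereal (G (Xh $ i))) - (f_sum f (ones_outer xs) + real CARD('m) * a) + V \<bullet> Xh
      \<le> 1 / real k * (1 / (2 * \<gamma>) * (wnorm D (X 0 - ones_outer xs))\<^sup>2
          + \<gamma> / 2 * (1 / lambda2 C) * (norm V)\<^sup>2)"
proof -
  have minor: "ereal (a + \<xi> \<bullet> (y - xs)) \<le> G y" for y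
    using \<xi> a by (auto simp: subdifferential_def)
  define r where "r t i = real_of_ereal (G (X t $ i))" for t i
  \<comment> \<open>\<open>X 0\<close> is arbitrary and may lie where \<open>G\<close> is infinite;
    finiteness starts with the first proximal step.\<close>
  have r: "G (X t $ i) = ereal (r t i)" if t: "t \<ge> 1" for t i
  proof -
    obtain u where "t = Suc u" using t not0_implies_Suc[of t] by auto
    then have "\<exists>s. G (X t $ i) = ereal s"
      using prox_g_sum_subgradient(1)[OF G_closed G_convex a \<xi> \<gamma>] by (simp add: X_step)
    then show ?thesis by (auto simp: r_def)
  qed
  have Xh_i: "Xh $ i = (1 / real k) *\<^sub>R (\<Sum>t=1..k. X t $ i)" for i by (simp add: Xh_def)
  have G_avg: "G (Xh $ i) \<le> ereal ((1 / real k) * (\<Sum>t=1..k. r t i))" for i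
    unfolding Xh_i using k r by (intro convex_fun_avg[OF G_convex]) auto
  show fin: "\<exists>s. G (Xh $ i) = ereal s" for i
    using G_avg[of i] minor[of "Xh $ i"] by (cases "G (Xh $ i)") auto
  define \<phi> where "\<phi> t = f_sum f (X t) + (\<Sum>i\<in>UNIV. r t i)" for t
  define opt where "opt = f_sum f (ones_outer xs) + real CARD('m) * a"
  have avg: "f_sum f Xh + (\<Sum>i\<in>UNIV. real_of_ereal (G (Xh $ i))) \<le> 1 / real k * (\<Sum>t=1..k. \<phi> t)"
  proof -
    have "f_sum f Xh \<le> (\<Sum>i\<in>UNIV. (1 / real k) * (\<Sum>t=1..k. f i (X t $ i)))"
      unfolding f_sum_def Xh_i by (intro sum_mono convex_on_fun_avg f_convex k)
    moreover have "real_of_ereal (G (Xh $ i)) \<le> (1 / real k) * (\<Sum>t=1..k. r t i)" for i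
      using fin[of i] G_avg[of i] by auto
    then have "(\<Sum>i\<in>UNIV. real_of_ereal (G (Xh $ i))) \<le> (\<Sum>i\<in>UNIV. (1 / real k) * (\<Sum>t=1..k. r t i))"
      by (intro sum_mono)
    moreover have "1 / real k * (\<Sum>t=1..k. \<phi> t) = (\<Sum>i\<in>UNIV. (1 / real k) * (\<Sum>t=1..k. f i (X t $ i)))
        + (\<Sum>i\<in>UNIV. (1 / real k) * (\<Sum>t=1..k. r t i))"
      unfolding \<phi>_def f_sum_def sum_distrib_left[symmetric] sum.distrib distrib_left
      by (simp add: sum.swap[where A = "UNIV :: 'm set"])
    ultimately show ?thesis by linarith
  qed
  have C1: "C *v 1 = 0" using C_null span_base[of 1 "{1}"] by (auto simp: null_space_def)
  have D1: "D *v 1 = 1" by (rule mixing_matrix_fixes_ones[OF C_sym D_sym C1 D_ones D_le])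
  let ?Xs = "ones_outer xs :: real^'d^'m"
  have Xs: "D ** ?Xs = ?Xs" "C ** ?Xs = 0"
    using matrix_mult_ones_outer[of D 1 xs] matrix_mult_ones_outer[of C 0 xs] D1 C1 by simp_all
  have D_ge: "\<gamma> * L * (x \<bullet> x) \<le> x \<bullet> (D *v x)" for x
    using mult_right_mono[OF \<gamma>_le, of "x \<bullet> x"] lambda_min_symmetric(2)[OF D_sym, of x] by simp
  define Z where "Z t = (\<Sum>u=1..t. X u)" for t
  have Z_Suc: "Z (Suc t) = Z t + X (Suc t)" for t by (simp add: Z_def)
  \<comment> \<open>Because \<open>Y 0 = 0\<close>, the dual updates add up to an image under
    \<open>C\<close>.\<close>
  have CZ: "\<gamma> *\<^sub>R Y t = C ** Z t" for t
  proof (induction t)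
    case (Suc t)
    then show ?case
      using \<gamma> by (simp add: Y_step Z_Suc scaleR_add_right linear_add[OF linear_matrix_mult])
  qed (simp add: Y0 Z_def linear_0[OF linear_matrix_mult])
  let ?qD = "\<lambda>E. E \<bullet> (D ** E)" and ?qC = "\<lambda>E. E \<bullet> (C ** E)"
  have step: "\<phi> (Suc t) - opt + (1 / \<gamma>) * ((C ** W) \<bullet> X (Suc t))
      \<le> 1 / (2 * \<gamma>) * (?qD (X t - ?Xs) - ?qD (X (Suc t) - ?Xs)
        + (?qC (Z t - W) - ?qC (Z (Suc t) - W)))" for t W
  proof -
    define S where "S = (1 / \<gamma>) *\<^sub>R (U (Suc t) - X (Suc t))"
    have S: "S $ i \<in> subdifferential G (X (Suc t) $ i)" for i
      using prox_g_sum_subgradient(2)[OF G_closed G_convex a \<xi> \<gamma>, of "U (Suc t)" i]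
      by (simp add: S_def X_step)
    have "r (Suc t) i - a \<le> S $ i \<bullet> (X (Suc t) $ i - xs)" for i
    proof -
      have "G (X (Suc t) $ i) + ereal (S $ i \<bullet> (xs - X (Suc t) $ i)) \<le> G xs"
        using S[of i] by (simp add: subdifferential_def)
      then show ?thesis using r[of "Suc t" i] by (simp add: a inner_diff_right)
    qed
    then have "(\<Sum>i\<in>UNIV. r (Suc t) i - a) \<le> (\<Sum>i\<in>UNIV. S $ i \<bullet> (X (Suc t) $ i - xs))"
      by (intro sum_mono)
    then have g: "(\<Sum>i\<in>UNIV. r (Suc t) i) - real CARD('m) * a \<le> S \<bullet> (X (Suc t) - ?Xs)"
      by (simp add: sum_subtractf inner_vec_def ones_outer_def)
    have "\<gamma> *\<^sub>R S = U (Suc t) - X (Suc t)" using \<gamma> by (simp add: S_def)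
    then have "\<gamma> *\<^sub>R (grad_rows f (X t) + S) = D ** X t - X (Suc t) - C ** Z t"
      by (simp add: scaleR_add_right U_step CZ[symmetric])
    from primal_dual_step[OF C_sym D_sym D_le D_ge Xs this \<gamma>, of W]
    have "(grad_rows f (X t) + S) \<bullet> (X (Suc t) - ?Xs) + L / 2 * (norm (X (Suc t) - X t))\<^sup>2
        + (1 / \<gamma>) * ((C ** W) \<bullet> X (Suc t))
        \<le> 1 / (2 * \<gamma>) * (?qD (X t - ?Xs) - ?qD (X (Suc t) - ?Xs)
        + (?qC (Z t - W) - ?qC (Z (Suc t) - W)))"
      unfolding Z_Suc .
    moreover have "f_sum f (X (Suc t)) - f_sum f ?Xs
        \<le> grad_rows f (X t) \<bullet> (X (Suc t) - ?Xs) + L / 2 * (norm (X (Suc t) - X t))\<^sup>2"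
      by (rule f_sum_descent[OF f_convex f_smooth])
    ultimately show ?thesis using g unfolding \<phi>_def opt_def inner_add_left by linarith
  qed
  have qD: "0 \<le> ?qD E" for E :: "real^'d^'m"
  proof -
    have "0 \<le> x \<bullet> (D *v x)" for x
      using D_pos by (cases "x = 0") (auto simp: loewner_less_def less_imp_le)
    then show ?thesis using quadratic_form_lower_bound_columns[of 0 D E] by simp
  qed
  have qC: "0 \<le> ?qC E" for E :: "real^'d^'m"
    using quadratic_form_lower_bound_columns[of 0 C E] C_psd by (simp add: loewner_le_def)
  \<comment> \<open>The terminal forms are kept for the induction and dropped later by
    \<open>qD\<close> and \<open>qC\<close>.\<close>
  have telescope: "(\<Sum>t=1..n. \<phi> t - opt + (1 / \<gamma>) * ((C ** W) \<bullet> X t))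
      \<le> 1 / (2 * \<gamma>) * (?qD (X 0 - ?Xs) + ?qC W - ?qD (X n - ?Xs) - ?qC (Z n - W))" for n W
  proof (induction n)
    case 0
    have "?qC (Z 0 - W) = ?qC W" by (simp add: Z_def linear_neg[OF linear_matrix_mult])
    then show ?case by simp
  next
    case (Suc n)
    then show ?case using step[of n W] by (simp add: algebra_simps)
  qed
  show "f_sum f Xh + (\<Sum>i\<in>UNIV. real_of_ereal (G (Xh $ i))) - (f_sum f (ones_outer xs) + real CARD('m) * a) + V \<bullet> Xh
      \<le> 1 / real k * (1 / (2 * \<gamma>) * (wnorm D (X 0 - ones_outer xs))\<^sup>2
          + \<gamma> / 2 * (1 / lambda2 C) * (norm V)\<^sup>2)"
    if V: "(\<Sum>i\<in>UNIV. V $ i) = 0"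
  proof -
    have lambda2_pos: "0 < lambda2 C" by (rule lambda2_null_span_one(1)[OF m2 C_sym C_psd C_null])
    \<comment> \<open>The scaling by \<open>\<gamma>\<close> cancels the \<open>1 / \<gamma>\<close>
      in front of \<open>C ** W\<close>; its square over \<open>2 * \<gamma>\<close> is the source
      of the factor \<open>\<gamma> / 2\<close>.\<close>
    have "(\<Sum>i\<in>UNIV. (\<gamma> *\<^sub>R V) $ i) = 0" using V by (simp add: scaleR_sum_right[symmetric])
    then obtain W where W: "C ** W = \<gamma> *\<^sub>R V" "lambda2 C * (W \<bullet> (\<gamma> *\<^sub>R V)) \<le> (\<gamma> *\<^sub>R V) \<bullet> (\<gamma> *\<^sub>R V)"
      using null_span_one_range_matrix[OF m2 C_sym C_psd C_null] by blast
    have CW: "?qC W \<le> \<gamma>\<^sup>2 * (norm V)\<^sup>2 / lambda2 C"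
      using W lambda2_pos
      by (simp add: field_simps power2_eq_square flip: power2_norm_eq_inner)
    have sum: "(\<Sum>t=1..k. \<phi> t - opt + (1 / \<gamma>) * ((C ** W) \<bullet> X t)) = (\<Sum>t=1..k. \<phi> t) - k * opt + V \<bullet> Z k"
      using \<gamma> by (simp add: W(1) Z_def sum.distrib sum_subtractf inner_sum_right)
    have eq: "1 / real k * (\<Sum>t=1..k. \<phi> t) - opt + V \<bullet> Xh
        = 1 / real k * (\<Sum>t=1..k. \<phi> t - opt + (1 / \<gamma>) * ((C ** W) \<bullet> X t))"
      unfolding sum using k by (simp add: Xh_def Z_def field_simps)
    have "(\<Sum>t=1..k. \<phi> t - opt + (1 / \<gamma>) * ((C ** W) \<bullet> X t))
        \<le> 1 / (2 * \<gamma>) * (?qD (X 0 - ?Xs) + ?qC W - ?qD (X k - ?Xs) - ?qC (Z k - W))"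
      by (rule telescope)
    also have "\<dots> \<le> 1 / (2 * \<gamma>) * (?qD (X 0 - ?Xs) + \<gamma>\<^sup>2 * (norm V)\<^sup>2 / lambda2 C)"
      using \<gamma> CW qD[of "X k - ?Xs"] qC[of "Z k - W"] by (intro mult_left_mono) auto
    also have "\<dots> = 1 / (2 * \<gamma>) * (wnorm D (X 0 - ?Xs))\<^sup>2 + \<gamma> / 2 * (1 / lambda2 C) * (norm V)\<^sup>2"
      using \<gamma> qD[of "X 0 - ?Xs"] by (simp add: wnorm_inner field_simps power2_eq_square)
    finally have "1 / real k * (\<Sum>t=1..k. \<phi> t - opt + (1 / \<gamma>) * ((C ** W) \<bullet> X t))
        \<le> 1 / real k * (1 / (2 * \<gamma>) * (wnorm D (X 0 - ?Xs))\<^sup>2 + \<gamma> / 2 * (1 / lambda2 C) * (norm V)\<^sup>2)"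
      by (intro mult_left_mono) simp_all
    then show ?thesis using avg eq unfolding opt_def by linarith
  qed
qed

text \<open>With \<open>e = norm E * norm Ys\<close>, a multiplier of norm at most
  \<open>2 * norm Ys\<close> gives \<open>\<delta> + 2 * e \<le> \<beta>\<close>, and the saddle
  point gives \<open>- e \<le> \<delta>\<close>. The factor 2 leaves one copy of \<open>e\<close>
  after adding, so \<open>e\<close> and \<open>\<bar>\<delta>\<bar>\<close> are both at most
  \<open>\<beta>\<close>; its square is the 4 in the bound.\<close>

lemma merit_le_of_gap:
  fixes f :: "'m::finite \<Rightarrow> real^'d \<Rightarrow> real" and G :: "real^'d \<Rightarrow> ereal" and Xh :: "real^'d^'m"
  assumes f_convex: "\<And>i. convex_on UNIV (f i)" and f_smooth: "\<And>i. L_smooth L (f i)"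
    and a: "G xs = ereal a" and \<xi>: "\<xi> \<in> subdifferential G xs" and \<xi>_opt: "\<xi> + grad (f_avg f) xs = 0"
    and fin: "\<And>i. \<exists>s. G (Xh $ i) = ereal s"
    and gap: "\<And>V. (\<Sum>i\<in>UNIV. V $ i) = 0 \<Longrightarrow>
      f_sum f Xh + (\<Sum>i\<in>UNIV. real_of_ereal (G (Xh $ i)))
        - (f_sum f (ones_outer xs) + real CARD('m) * a) + V \<bullet> Xh \<le> A + B * (norm V)\<^sup>2"
    and B: "0 \<le> B"
  shows "merit f G (ones_outer xs) (- (grad_rows f (ones_outer xs) + ones_outer \<xi>)) Xh
    \<le> ereal (A + 4 * B * (norm (grad_rows f (ones_outer xs)))\<^sup>2)"
proof -
  let ?Xs = "ones_outer xs :: real^'d^'m" and ?N = "grad_rows f (ones_outer xs)"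
  define Ys where "Ys = - (?N + ones_outer \<xi>)"
  define \<delta> where "\<delta> = f_sum f Xh + (\<Sum>i\<in>UNIV. real_of_ereal (G (Xh $ i))) - (f_sum f ?Xs + real CARD('m) * a)"
  define E where "E = (mat 1 - J_mat) ** Xh"
  define \<beta> where "\<beta> = A + 4 * B * (norm ?N)\<^sup>2"
  have inner_ones: "Q \<bullet> ones_outer x = (\<Sum>i\<in>UNIV. Q $ i) \<bullet> x" for Q :: "real^'d^'m" and x
    by (simp add: inner_vec_def[of Q] ones_outer_def inner_sum_left)
  have "f i differentiable (at xs)" for i using f_smooth by (simp add: L_smooth_def)
  then have "\<xi> = - ((1 / real CARD('m)) *\<^sub>R (\<Sum>i\<in>UNIV. grad (f i) xs))"
    using \<xi>_opt grad_f_avg[of f xs] by (simp add: eq_neg_iff_add_eq_0)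
  then have Ys_sum: "(\<Sum>i\<in>UNIV. Ys $ i) = 0"
    by (simp add: Ys_def grad_rows_def ones_outer_def sum_negf sum_subtractf sum_constant_scaleR del: sum_constant)
  \<comment> \<open>The rows of \<open>Ys\<close> sum to 0, so it is orthogonal to matrices with
    equal rows and Pythagoras applies.\<close>
  have "?N = - Ys - ones_outer \<xi>" by (simp add: Ys_def)
  then have "(norm ?N)\<^sup>2 = (norm Ys)\<^sup>2 + (norm (ones_outer \<xi> :: real^'d^'m))\<^sup>2"
    unfolding power2_norm_eq_inner
    using inner_ones[of Ys \<xi>] Ys_sum by (simp add: inner_diff_left inner_diff_right inner_commute)
  then have Ys_le: "(norm Ys)\<^sup>2 \<le> (norm ?N)\<^sup>2" by simp
  \<comment> \<open>\<open>J_mat\<close> replaces every row by the mean row. Hence the rows of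
    \<open>E\<close> sum to 0 and multiples of \<open>E\<close> are admissible in
    \<open>gap\<close>.\<close>
  define xbar where "xbar = (1 / real CARD('m)) *\<^sub>R (\<Sum>i\<in>UNIV. Xh $ i)"
  have "(J_mat ** Xh) = ones_outer xbar"
    by (simp add: J_mat_def matrix_matrix_mult_def ones_outer_def xbar_def vec_eq_iff sum_divide_distrib)
  then have E: "Xh = E + ones_outer xbar" by (simp add: E_def matrix_diff_rdistrib)
  have "(\<Sum>i\<in>UNIV. E $ i) = (\<Sum>i\<in>UNIV. Xh $ i) - real CARD('m) *\<^sub>R xbar"
    by (subst E) (simp add: sum.distrib ones_outer_def sum_constant_scaleR del: sum_constant)
  then have E_sum: "(\<Sum>i\<in>UNIV. E $ i) = 0" by (simp add: xbar_def)
  have inner_E: "Q \<bullet> Xh = Q \<bullet> E" if "(\<Sum>i\<in>UNIV. Q $ i) = 0" for Q :: "real^'d^'m"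
    by (subst E) (simp add: inner_add_right inner_ones that)
  have lower: "- (norm E * norm Ys) \<le> \<delta>"
  proof -
    have "a + \<xi> \<bullet> (Xh $ i - xs) \<le> real_of_ereal (G (Xh $ i))" for i
    proof -
      have "G xs + ereal (\<xi> \<bullet> (Xh $ i - xs)) \<le> G (Xh $ i)" using \<xi> by (simp add: subdifferential_def)
      then show ?thesis using fin[of i] a by auto
    qed
    then have "(\<Sum>i\<in>UNIV. a + \<xi> \<bullet> (Xh $ i - xs)) \<le> (\<Sum>i\<in>UNIV. real_of_ereal (G (Xh $ i)))"
      by (intro sum_mono)
    then have "real CARD('m) * a + (ones_outer \<xi>) \<bullet> (Xh - ?Xs) \<le> (\<Sum>i\<in>UNIV. real_of_ereal (G (Xh $ i)))"
      unfolding inner_vec_def[of "ones_outer \<xi>"] by (simp add: sum.distrib ones_outer_def)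
    moreover have "f_sum f ?Xs + ?N \<bullet> (Xh - ?Xs) \<le> f_sum f Xh"
      by (rule f_sum_gradient_ineq[OF f_convex f_smooth])
    ultimately have "- (Ys \<bullet> (Xh - ?Xs)) \<le> \<delta>" by (simp add: \<delta>_def Ys_def inner_add_left inner_diff_left)
    moreover have "Ys \<bullet> (Xh - ?Xs) = Ys \<bullet> E"
      using inner_E[OF Ys_sum] by (simp add: inner_diff_right inner_ones Ys_sum)
    moreover have "Ys \<bullet> E \<le> norm E * norm Ys" using norm_cauchy_schwarz[of Ys E] by (simp add: mult.commute)
    ultimately show ?thesis by linarith
  qed
  have upper: "\<delta> + 2 * (norm E * norm Ys) \<le> \<beta>"
  proof -
    \<comment> \<open>If \<open>E = 0\<close>, division by zero makes \<open>V = 0\<close>, which also works.\<close>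
    define V where "V = (2 * norm Ys / norm E) *\<^sub>R E"
    have "(\<Sum>i\<in>UNIV. V $ i) = 0" using E_sum by (simp add: V_def scaleR_sum_right[symmetric])
    from gap[OF this] have "\<delta> + V \<bullet> E \<le> A + B * (norm V)\<^sup>2"
      unfolding \<delta>_def inner_E[OF \<open>(\<Sum>i\<in>UNIV. V $ i) = 0\<close>] .
    moreover have "V \<bullet> E = 2 * (norm E * norm Ys)"
      by (simp add: V_def dot_square_norm power2_eq_square)
    moreover have "norm V \<le> 2 * norm Ys" by (simp add: V_def)
    then have "(norm V)\<^sup>2 \<le> (2 * norm Ys)\<^sup>2" by (intro power_mono) auto
    then have "(norm V)\<^sup>2 \<le> 4 * (norm Ys)\<^sup>2" by (simp add: power_mult_distrib)
    then have "(norm V)\<^sup>2 \<le> 4 * (norm ?N)\<^sup>2" using Ys_le by linarith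
    then have "B * (norm V)\<^sup>2 \<le> B * (4 * (norm ?N)\<^sup>2)" using B by (rule mult_left_mono)
    ultimately show ?thesis by (simp add: \<beta>_def)
  qed
  have "0 \<le> norm E * norm Ys" by simp
  with lower upper have "norm E * norm Ys \<le> \<beta>" "\<bar>\<delta>\<bar> \<le> \<beta>" by linarith+
  moreover have "fg_obj f G Xh - fg_obj f G ?Xs = ereal \<delta>"
  proof -
    have "G (Xh $ i) = ereal (real_of_ereal (G (Xh $ i)))" for i using fin[of i] by auto
    then have "g_sum G Xh = ereal (\<Sum>i\<in>UNIV. real_of_ereal (G (Xh $ i)))"
      unfolding g_sum_def sum_ereal[symmetric] by (intro sum.cong) auto
    moreover have "g_sum G ?Xs = ereal (real CARD('m) * a)"
      by (simp add: g_sum_def ones_outer_def a)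
    ultimately show ?thesis by (simp add: fg_obj_def \<delta>_def)
  qed
  ultimately show ?thesis
    unfolding merit_def Ys_def[symmetric] E_def[symmetric] \<beta>_def[symmetric] by simp
qed

section \<open>Optimal stepsize and the final rate\<close>

text \<open>The difference of the objective at \<open>s\<close> and \<open>\<gamma>\<close> factors
  as \<open>c * (s - \<gamma>) * (4 * (l * N) * s * \<gamma> - A) / (2 * s * \<gamma>)\<close>. Both
  factors that change sign are negative if \<open>\<gamma>\<close> is the right endpoint, and they
  combine to a square at the critical point. Strictness gives uniqueness.\<close>

lemma stepsize_minimizer:
  fixes A N T c l \<gamma> :: real
  assumes c: "0 < c" and A: "0 < A" and lN: "0 \<le> l * N" and \<gamma>: "0 < \<gamma>" "\<gamma> \<le> T"
    and le: "4 * (l * N) * \<gamma>\<^sup>2 \<le> A" and cases: "\<gamma> = T \<or> 4 * (l * N) * \<gamma>\<^sup>2 = A"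
  shows "is_arg_min (\<lambda>s. c * (1 / (2 * s) * A + 2 * s * l * N)) (\<lambda>s. s \<in> {0<..T}) \<gamma>' \<longleftrightarrow> \<gamma>' = \<gamma>"
proof -
  let ?h = "\<lambda>s. c * (1 / (2 * s) * A + 2 * s * l * N)"
  have less: "?h \<gamma> < ?h s" if s: "0 < s" "s \<le> T" "s \<noteq> \<gamma>" for s
  proof -
    have "0 < (s - \<gamma>) * (4 * (l * N) * s * \<gamma> - A)"
      using cases
    proof
      assume "\<gamma> = T"
      then have "s < \<gamma>" using s by simp
      have "4 * (l * N) * s * \<gamma> < A"
      proof (cases "l * N = 0")
        case False
        then have "0 < l * N" using lN by linarith
        then have "0 < 4 * (l * N) * \<gamma>" using mult_pos_pos \<gamma>(1) zero_less_numeral by metis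
        with \<open>s < \<gamma>\<close> have "4 * (l * N) * \<gamma> * s < 4 * (l * N) * \<gamma> * \<gamma>"
          by (rule mult_strict_left_mono)
        then show ?thesis using le by (simp add: power2_eq_square mult_ac)
      next
        case True
        show ?thesis unfolding True using A by simp
      qed
      then show ?thesis using \<open>s < \<gamma>\<close> by (intro mult_neg_neg) auto
    next
      assume eq: "4 * (l * N) * \<gamma>\<^sup>2 = A"
      then have "l * N \<noteq> 0" using A by (metis less_irrefl mult_zero_left mult_zero_right)
      then have "l * N > 0" using lN by linarith
      have "(s - \<gamma>) * (4 * (l * N) * s * \<gamma> - A) = 4 * (l * N) * \<gamma> * (s - \<gamma>)\<^sup>2"
        unfolding eq[symmetric] by (simp add: power2_eq_square algebra_simps)
      also have "0 < \<dots>"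
        using mult_pos_pos[OF mult_pos_pos[OF mult_pos_pos[OF _ \<open>l * N > 0\<close>] \<gamma>(1)], of 4 "(s - \<gamma>)\<^sup>2"] s by simp
      finally show ?thesis .
    qed
    then have "0 < c * ((s - \<gamma>) * (4 * (l * N) * s * \<gamma> - A)) / (2 * s * \<gamma>)" using c s \<gamma> by simp
    also have "\<dots> = ?h s - ?h \<gamma>" using s \<gamma> by (simp add: field_simps)
    finally show ?thesis by simp
  qed
  show ?thesis
  proof
    assume "is_arg_min ?h (\<lambda>s. s \<in> {0<..T}) \<gamma>'"
    then show "\<gamma>' = \<gamma>" using less[of \<gamma>'] \<gamma> by (auto simp: is_arg_min_def)
  next
    assume "\<gamma>' = \<gamma>"
    then show "is_arg_min ?h (\<lambda>s. s \<in> {0<..T}) \<gamma>'"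
      using less \<gamma> by (auto simp: is_arg_min_linorder) (metis less_imp_le order_refl)
  qed
qed

text \<open>The case distinction in \<open>\<gamma>_eq\<close> encodes the infinite second argument
  of the minimum, as division by zero would make it 0. \<open>m2\<close> and \<open>L_pos\<close>
  give meaning to \<open>lambda2 C\<close> and the stepsize interval.\<close>

theorem corollary28:
  fixes f :: "'m::finite \<Rightarrow> real^'d \<Rightarrow> real"
    and G :: "real^'d \<Rightarrow> ereal"
    and L \<gamma> :: real
    and xs \<xi> :: "real^'d"
    and C D :: "real^'m^'m"
    and X U Y :: "nat \<Rightarrow> real^'d^'m"
    and Xs Ys :: "real^'d^'m"
  assumes m2: "CARD('m) \<ge> 2"
    and L_pos: "L > 0"
    and f_convex: "\<And>i. convex_on UNIV (f i)"
    and f_smooth: "\<And>i. L_smooth L (f i)"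
    and G_proper: "proper_fun G"
    and G_closed: "closed_fun G"
    and G_convex: "convex_fun G"
    and xs_opt: "is_arg_min (\<lambda>x. ereal (f_avg f x) + G x) (\<lambda>_. True) xs"
    and Xs_eq: "Xs = ones_outer xs"
    and \<xi>_subgrad: "\<xi> \<in> subdifferential G xs"
    and \<xi>_opt: "\<xi> + grad (f_avg f) xs = 0"
    and Ys_eq: "Ys = - (grad_rows f Xs + ones_outer \<xi>)"
    and C_sym: "symmetric_matrix C"
    and D_sym: "symmetric_matrix D"
    and D_ones: "1 \<bullet> (D *v 1) = real CARD('m)"
    and C_psd: "loewner_le 0 C"
    and C_null: "null_space C = span {1}"
    and D_pos: "loewner_less 0 D"
    and D_le: "loewner_le D (mat 1 - (1/2) *\<^sub>R C)"
    and X0: "X 0 \<noteq> Xs"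
    and Y0: "Y 0 = 0"
    and U_step: "\<And>k. U (Suc k) = D ** X k - \<gamma> *\<^sub>R (grad_rows f (X k) + Y k)"
    and X_step: "\<And>k. X (Suc k) = prox \<gamma> (g_sum G) (U (Suc k))"
    and Y_step: "\<And>k. Y (Suc k) = Y k + (1 / \<gamma>) *\<^sub>R (C ** X (Suc k))"
    and \<gamma>_eq: "\<gamma> = (if grad_rows f Xs = 0 then lambda_min D / L
                  else min (lambda_min D / L)
                           (1/2 * sqrt (lambda2 C) * (wnorm D (X 0 - Xs) / norm (grad_rows f Xs))))"
  shows "(\<forall>k\<ge>1. \<forall>\<gamma>'.
            is_arg_min
              (\<lambda>s. 1 / real k * (1 / (2 * s) * (wnorm D (X 0 - Xs))\<^sup>2
                               + 2 * s * (1 / lambda2 C) * (norm (grad_rows f Xs))\<^sup>2))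
              (\<lambda>s. s \<in> {0<..lambda_min D / L}) \<gamma>' \<longleftrightarrow> \<gamma>' = \<gamma>)
         \<and> (\<forall>k\<ge>1. merit f G Xs Ys ((1 / real k) *\<^sub>R (\<Sum>t=1..k. X t))
              \<le> ereal (1 / real k *
                  max (L * (wnorm D (X 0 - Xs))\<^sup>2 / lambda_min D)
                      (2 * sqrt (1 / lambda2 C) * wnorm D (X 0 - Xs) * norm (grad_rows f Xs))))"
proof (intro conjI allI impI)
  define w N \<Lambda> where "w = wnorm D (X 0 - Xs)" and "N = norm (grad_rows f Xs)" and "\<Lambda> = lambda2 C"
  define T where "T = lambda_min D / L"
  have \<Lambda>: "0 < \<Lambda>" unfolding \<Lambda>_def by (rule lambda2_null_span_one(1)[OF m2 C_sym C_psd C_null])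
  have lmin: "0 < lambda_min D" by (rule lambda_min_pos[OF D_sym D_pos])
  have T: "0 < T" using lmin L_pos by (simp add: T_def)
  have w: "0 < w"
  proof -
    have "lambda_min D * ((X 0 - Xs) \<bullet> (X 0 - Xs)) \<le> (X 0 - Xs) \<bullet> (D ** (X 0 - Xs))"
      by (intro quadratic_form_lower_bound_columns lambda_min_symmetric(2) D_sym)
    moreover have "0 < lambda_min D * ((X 0 - Xs) \<bullet> (X 0 - Xs))" using lmin X0 by simp
    ultimately have "0 < (X 0 - Xs) \<bullet> (D ** (X 0 - Xs))" by linarith
    then show ?thesis by (simp add: w_def wnorm_inner)
  qed
  define \<gamma>0 where "\<gamma>0 = 1/2 * sqrt \<Lambda> * (w / N)"
  have N0: "N = 0 \<longleftrightarrow> grad_rows f Xs = 0" "0 \<le> N" by (simp_all add: N_def)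
  have \<gamma>_cases: "\<gamma> = (if N = 0 then T else min T \<gamma>0)"
    using \<gamma>_eq N0 by (simp add: T_def \<gamma>0_def w_def N_def \<Lambda>_def)
  \<comment> \<open>\<open>\<gamma>0\<close> is the critical point of the bound, where its two terms
    agree.\<close>
  have \<gamma>0_sq: "4 * (1 / \<Lambda> * N\<^sup>2) * \<gamma>0\<^sup>2 = w\<^sup>2" if "N \<noteq> 0"
    using that \<Lambda> by (simp add: \<gamma>0_def field_simps)
  have \<gamma>0: "0 < \<gamma>0" if "N \<noteq> 0" using that \<Lambda> w N0 by (simp add: \<gamma>0_def)
  have \<gamma>: "0 < \<gamma>" "\<gamma> \<le> T" using \<gamma>_cases T \<gamma>0 by (auto split: if_splits)
  have le: "4 * (1 / \<Lambda> * N\<^sup>2) * \<gamma>\<^sup>2 \<le> w\<^sup>2"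
  proof (cases "N = 0")
    case False
    then have "\<gamma>\<^sup>2 \<le> \<gamma>0\<^sup>2" using \<gamma>(1) \<gamma>_cases by (intro power_mono) auto
    then have "4 * (1 / \<Lambda> * N\<^sup>2) * \<gamma>\<^sup>2 \<le> 4 * (1 / \<Lambda> * N\<^sup>2) * \<gamma>0\<^sup>2" using \<Lambda> by (intro mult_left_mono) auto
    then show ?thesis using \<gamma>0_sq[OF False] by simp
  qed simp
  have alt: "\<gamma> = T \<or> (N \<noteq> 0 \<and> \<gamma> = \<gamma>0)" using \<gamma>_cases by (auto simp: min_def)
  fix k :: nat assume k: "1 \<le> k"
  show "is_arg_min
      (\<lambda>s. 1 / real k * (1 / (2 * s) * (wnorm D (X 0 - Xs))\<^sup>2
                       + 2 * s * (1 / lambda2 C) * (norm (grad_rows f Xs))\<^sup>2))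
      (\<lambda>s. s \<in> {0<..lambda_min D / L}) \<gamma>' \<longleftrightarrow> \<gamma>' = \<gamma>" for \<gamma>'
    unfolding w_def[symmetric] N_def[symmetric] \<Lambda>_def[symmetric] T_def[symmetric]
  proof (rule stepsize_minimizer)
    show "\<gamma> = T \<or> 4 * (1 / \<Lambda> * N\<^sup>2) * \<gamma>\<^sup>2 = w\<^sup>2" using alt \<gamma>0_sq by blast
  qed (use k w \<Lambda> \<gamma> le in auto)
  \<comment> \<open>Optimality against a point where \<open>G\<close> is finite makes
    \<open>G xs\<close> finite.\<close>
  obtain a where a: "G xs = ereal a"
  proof -
    obtain y where y: "G y \<noteq> \<infinity>" using G_proper by (auto simp: proper_fun_def)
    have "ereal (f_avg f xs) + G xs \<le> ereal (f_avg f y) + G y"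
      using xs_opt by (simp add: is_arg_min_linorder)
    then have "G xs \<noteq> \<infinity>" using y by auto
    moreover have "G xs \<noteq> -\<infinity>" using G_proper by (simp add: proper_fun_def)
    ultimately show thesis using that by (cases "G xs") auto
  qed
  let ?Xh = "(1 / real k) *\<^sub>R (\<Sum>t=1..k. X t)"
  have \<gamma>L: "\<gamma> * L \<le> lambda_min D" using \<gamma>(2) L_pos by (simp add: T_def field_simps)
  note gap = ergodic_gap_bound[OF m2 f_convex f_smooth G_closed G_convex a \<xi>_subgrad C_sym D_sym D_ones
      C_psd C_null D_pos D_le Y0 U_step X_step Y_step \<gamma>(1) \<gamma>L k]
  have "merit f G Xs Ys ?Xh
      \<le> ereal (1 / real k * (1 / (2 * \<gamma>) * w\<^sup>2) + 4 * (1 / real k * (\<gamma> / 2 * (1 / \<Lambda>))) * N\<^sup>2)"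
    unfolding Ys_eq N_def Xs_eq
  proof (rule merit_le_of_gap[OF f_convex f_smooth a \<xi>_subgrad \<xi>_opt gap(1)])
    show "f_sum f ?Xh + (\<Sum>i\<in>UNIV. real_of_ereal (G (?Xh $ i)))
        - (f_sum f (ones_outer xs) + real CARD('m) * a) + V \<bullet> ?Xh
      \<le> 1 / real k * (1 / (2 * \<gamma>) * w\<^sup>2) + 1 / real k * (\<gamma> / 2 * (1 / \<Lambda>)) * (norm V)\<^sup>2"
      if "(\<Sum>i\<in>UNIV. V $ i) = 0" for V :: "real^'d^'m"
      using gap(2)[OF that] unfolding w_def \<Lambda>_def Xs_eq by (simp only: distrib_left mult.assoc)
    show "0 \<le> 1 / real k * (\<gamma> / 2 * (1 / \<Lambda>))" using \<gamma> \<Lambda> by simp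
  qed
  \<comment> \<open>The factor 4 from the merit estimate turns \<open>\<gamma> / 2\<close> into the
    \<open>2 * \<gamma>\<close> of the minimized bound.\<close>
  also have "1 / real k * (1 / (2 * \<gamma>) * w\<^sup>2) + 4 * (1 / real k * (\<gamma> / 2 * (1 / \<Lambda>))) * N\<^sup>2
      = 1 / real k * (1 / (2 * \<gamma>) * w\<^sup>2 + 2 * \<gamma> / \<Lambda> * N\<^sup>2)"
    by (simp add: algebra_simps)
  \<comment> \<open>At \<open>\<gamma> = T\<close> the second term is at most the first, so the sum
    is at most \<open>w^2 / T\<close>; at \<open>\<gamma>0\<close> both terms equal
    \<open>w * N / sqrt \<Lambda>\<close>.\<close>
  also have "1 / (2 * \<gamma>) * w\<^sup>2 + 2 * \<gamma> / \<Lambda> * N\<^sup>2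
      \<le> max (L * w\<^sup>2 / lambda_min D) (2 * sqrt (1 / \<Lambda>) * w * N)"
    using alt
  proof
    assume eq: "\<gamma> = T"
    have "2 * \<gamma> / \<Lambda> * N\<^sup>2 = 1 / (2 * \<gamma>) * (4 * (1 / \<Lambda> * N\<^sup>2) * \<gamma>\<^sup>2)"
      using \<gamma>(1) by (simp add: field_simps power2_eq_square)
    also have "\<dots> \<le> 1 / (2 * \<gamma>) * w\<^sup>2" using le \<gamma>(1) by (intro mult_left_mono) auto
    finally have "1 / (2 * \<gamma>) * w\<^sup>2 + 2 * \<gamma> / \<Lambda> * N\<^sup>2 \<le> 1 / \<gamma> * w\<^sup>2" by (simp add: field_simps)
    also have "\<dots> = L * w\<^sup>2 / lambda_min D" by (simp add: eq T_def)
    finally show ?thesis by simp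
  next
    assume eq: "N \<noteq> 0 \<and> \<gamma> = \<gamma>0"
    have "1 / (2 * \<gamma>) * w\<^sup>2 = w * N / sqrt \<Lambda>"
      using eq w \<Lambda> by (simp add: \<gamma>0_def field_simps power2_eq_square)
    moreover have "2 * \<gamma> / \<Lambda> * N\<^sup>2 = w * N / sqrt \<Lambda>"
    proof -
      have "2 * \<gamma> / \<Lambda> * N\<^sup>2 = w * N * (sqrt \<Lambda> / \<Lambda>)"
        using eq by (simp add: \<gamma>0_def power2_eq_square)
      also have "sqrt \<Lambda> / \<Lambda> = inverse (sqrt \<Lambda>)" using \<Lambda> by (intro sqrt_divide_self_eq) simp
      finally show ?thesis by (simp add: divide_inverse)
    qed
    ultimately have "1 / (2 * \<gamma>) * w\<^sup>2 + 2 * \<gamma> / \<Lambda> * N\<^sup>2 = 2 * sqrt (1 / \<Lambda>) * w * N"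
      by (simp add: real_sqrt_divide)
    then show ?thesis by simp
  qed
  finally show "merit f G Xs Ys ?Xh
      \<le> ereal (1 / real k * max (L * (wnorm D (X 0 - Xs))\<^sup>2 / lambda_min D)
                (2 * sqrt (1 / lambda2 C) * wnorm D (X 0 - Xs) * norm (grad_rows f Xs)))"
    unfolding w_def N_def \<Lambda>_def by (simp add: mult_left_mono divide_right_mono)
qed

end
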